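(* Consider the Poisson small-world random graph on $n$ with parameters $\alpha > 2$, and arbitrarily large constants $c > 0$ and $\overline{d} > 0$. Suppose the source $s$ and destination $t$ are chosen uniformly at random from the node set. Then, for any $\gamma < (\alpha-2)/(2(\alpha-1))$, the number of hops for message delivery from $s$ to $t$ in any decentralised routing algorithm exceeds $n^{\gamma}$ with high probability, i.e. with probability tending to $1$ as $n \to \infty$.
   Context: **Model.** For each $n \in \mathbb{N}$ a random graph is defined as follows. Nodes are the points of a Poisson process of rate $1$ on the square $[0,\sqrt{n}]^2$. The distance $r(u,v)$ is the Euclidean distance, with edge effects ignored, i.e. distances are those on the torus obtained by identifying opposite edges of the square. Each node $x$ is linked to all nodes at distance less than $\sqrt{c \log n}$ from it; these links are called local edges and the corresponding nodes the local contacts of $x$. For two nodes $u,v$ with $r(u,v) > \sqrt{c\log n}$, the edge $(u,v)$ is present with probability $\min(a_n r(u,v)^{-\alpha}, 1)$, independently for different node pairs (given the node positions); such edges are called shortcuts, and their endpoints are shortcut contacts of each other. The parameter $a_n$ is chosen so that the expected number of shortcuts per node equals the specified constant $\overline{d}$. **Decentralised routing algorithm.** Each node knows its own location, the locations of all its local contacts (those within distance $\sqrt{c\log n}$) and of all its shortcut neighbours (including nodes from which shortcuts are incident to it), and the location of the destination $t$. There is no global knowledge of the graph topology. A decentralised routing algorithm specifies a (possibly random) sequence of nodes $s = x_0, x_1, \ldots, x_k = t, x_{k+1} = t, \ldots$ where each node $x_i$ is chosen from among the local or shortcut contacts of the nodes $\{x_0,\ldots,x_{i-1}\}$, the choice being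 based only on the information known to the nodes $x_0,\ldots,x_{i-1}$ (and possibly independent randomisation). The number of hops is the first index $k$ with $x_k = t$ (infinite if there is none). *)

theory Defs
  imports "HOL-Probability.Probability"
begin

type_synonym point = "real \<times> real"

definition square :: "nat \<Rightarrow> point set" where
  "square n = {0..sqrt n} \<times> {0..sqrt n}"

definition circle_dist :: "real \<Rightarrow> real \<Rightarrow> real \<Rightarrow> real" where
  "circle_dist l x y = min \<bar>x - y\<bar> (l - \<bar>x - y\<bar>)"

text \<open>Euclidean distance on the torus obtained from \<^term>\<open>square n\<close>.\<close>

definition torus_dist :: "nat \<Rightarrow> point \<Rightarrow> point \<Rightarrow> real" where
  "torus_dist n x y =
     sqrt ((circle_dist (sqrt n) (fst x) (fst y))\<^sup>2 + (circle_dist (sqrt n) (snd x) (snd y))\<^sup>2)"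

definition local_radius :: "real \<Rightarrow> nat \<Rightarrow> real" where
  "local_radius c n = sqrt (c * ln n)"


subsection \<open>The nodes\<close>

definition points :: "('a \<Rightarrow> nat) \<Rightarrow> (nat \<Rightarrow> 'a \<Rightarrow> point) \<Rightarrow> 'a \<Rightarrow> point set" where
  "points N X \<omega> = (\<lambda>i. X i \<omega>) ` {..<N \<omega>}"

text \<open>
  The library specifies \<^const>\<open>poisson_pmf\<close> for positive means only; mean \<open>0\<close> is needed for null sets.
\<close>

definition poisson_law :: "real \<Rightarrow> nat pmf" where
  "poisson_law m = (if m = 0 then return_pmf 0 else poisson_pmf m)"

text \<open>
  The random finite set \<^term>\<open>points N X\<close> is a homogeneous Poisson process on the bounded region
  \<open>S\<close>: the numbers of points in disjoint Borel subsets of \<open>S\<close> are independent and Poisson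
  distributed with mean \<open>rate\<close> times the area. The points come with some measurable enumeration
  \<open>X 0, \<dots>, X (N - 1)\<close> without repetitions, about which nothing else is assumed (the values
  \<open>X i\<close> for \<open>i \<ge> N\<close> are irrelevant).
\<close>

definition poisson_process ::
    "'a measure \<Rightarrow> real \<Rightarrow> point set \<Rightarrow> ('a \<Rightarrow> nat) \<Rightarrow> (nat \<Rightarrow> 'a \<Rightarrow> point) \<Rightarrow> bool" where
  "poisson_process P rate S N X \<longleftrightarrow>
     prob_space P \<and>
     N \<in> measurable P (count_space UNIV) \<and>
     (\<forall>i. X i \<in> borel_measurable P) \<and>
     (AE \<omega> in P. inj_on (\<lambda>i. X i \<omega>) {..<N \<omega>} \<and> points N X \<omega> \<subseteq> S) \<and>
     (\<forall>B\<in>sets borel. B \<subseteq> S \<longrightarrow>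
        distr P (count_space UNIV) (\<lambda>\<omega>. card (points N X \<omega> \<inter> B)) =
        measure_pmf (poisson_law (rate * measure lborel B))) \<and>
     (\<forall>(I :: nat set) B. finite I \<longrightarrow> disjoint_family_on B I \<longrightarrow>
        (\<forall>i\<in>I. B i \<in> sets borel \<and> B i \<subseteq> S) \<longrightarrow>
        prob_space.indep_vars P (\<lambda>_. count_space UNIV) (\<lambda>i \<omega>. card (points N X \<omega> \<inter> B i)) I)"


subsection \<open>The edges\<close>

text \<open>
  Each pair \<open>{i, j}\<close> of indices carries a mark, the marks being i.i.d. uniform on \<open>[0, 1]\<close> and
  independent of the points. A shortcut joins the \<open>i\<close>-th and the \<open>j\<close>-th point if the mark of
  \<open>{i, j}\<close> is below the prescribed edge probability; given the points, shortcuts are thus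
  present independently and with these probabilities.
\<close>

definition edge_marks :: "(nat set \<Rightarrow> real) measure" where
  "edge_marks = (\<Pi>\<^sub>M e\<in>{e. card e = 2}. uniform_measure lborel {0..1})"

definition graph_space :: "'a measure \<Rightarrow> ('a \<times> (nat set \<Rightarrow> real)) measure" where
  "graph_space P = P \<Otimes>\<^sub>M edge_marks"

definition shortcuts ::
    "real \<Rightarrow> real \<Rightarrow> real \<Rightarrow> nat \<Rightarrow> ('a \<Rightarrow> nat) \<Rightarrow> (nat \<Rightarrow> 'a \<Rightarrow> point)
      \<Rightarrow> 'a \<times> (nat set \<Rightarrow> real) \<Rightarrow> (point \<times> point) set" where
  "shortcuts c \<alpha> a n N X = (\<lambda>(\<omega>, u).
     {(X i \<omega>, X j \<omega>) | i j. i < N \<omega> \<and> j < N \<omega> \<and> i \<noteq> j \<and>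
        torus_dist n (X i \<omega>) (X j \<omega>) > local_radius c n \<and>
        u {i, j} < min (a * torus_dist n (X i \<omega>) (X j \<omega>) powr (- \<alpha>)) 1})"

definition local_contacts :: "real \<Rightarrow> nat \<Rightarrow> point set \<Rightarrow> point \<Rightarrow> point set" where
  "local_contacts c n V x = {y\<in>V. y \<noteq> x \<and> torus_dist n x y < local_radius c n}"

definition shortcut_contacts :: "(point \<times> point) set \<Rightarrow> point \<Rightarrow> point set" where
  "shortcut_contacts E x = {y. (x, y) \<in> E}"

text \<open>
  Expected number of shortcuts of a typical node, i.e. the expected sum over all nodes of their
  numbers of shortcuts, divided by the expected number of nodes.
\<close>

definition mean_shortcuts ::
    "real \<Rightarrow> real \<Rightarrow> real \<Rightarrow> nat \<Rightarrow> 'a measure \<Rightarrow> ('a \<Rightarrow> nat) \<Rightarrow> (nat \<Rightarrow> 'a \<Rightarrow> point) \<Rightarrow> real" where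
  "mean_shortcuts c \<alpha> a n P N X =
     (LINT g|graph_space P.
        (\<Sum>x\<in>points N X (fst g). real (card (shortcut_contacts (shortcuts c \<alpha> a n N X g) x))))
     / (LINT \<omega>|P. real (card (points N X \<omega>)))"


subsection \<open>Decentralised routing\<close>

text \<open>
  What a single node knows: its own location, and the locations of its local and of its shortcut
  contacts. Nodes are identified with their locations; the enumeration is not part of it.
\<close>

type_synonym knowledge = "point \<times> point set \<times> point set"

definition knowledge :: "real \<Rightarrow> nat \<Rightarrow> point set \<Rightarrow> (point \<times> point) set \<Rightarrow> point \<Rightarrow> knowledge" where
  "knowledge c n V E x = (x, local_contacts c n V x, shortcut_contacts E x)"

definition known_contacts :: "knowledge list \<Rightarrow> point set" where
  "known_contacts h = (\<Union>(x, L, S)\<in>set h. L \<union> S)"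

text \<open>
  An algorithm \<open>A\<close> maps a random seed \<open>w\<close>, the destination \<open>t\<close> and the list \<open>h\<close> of what the nodes
  \<open>x\<^sub>0, \<dots>, x\<^sub>k\<close> know to the node \<open>x\<^sub>k\<^sub>+\<^sub>1\<close>, which has to be a contact of one of
  \<open>x\<^sub>0, \<dots>, x\<^sub>k\<close>. There is no admissible choice if none of them has a contact, which only
  happens for an isolated source; the message then stays where it is.
\<close>

type_synonym 'w algorithm = "'w \<Rightarrow> point \<Rightarrow> knowledge list \<Rightarrow> point"

definition decentralised_algorithm :: "'w set \<Rightarrow> 'w algorithm \<Rightarrow> bool" where
  "decentralised_algorithm W A \<longleftrightarrow>
     (\<forall>w\<in>W. \<forall>t h. known_contacts h \<noteq> {} \<longrightarrow> A w t h \<in> known_contacts h)"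

primrec visited ::
    "(point \<Rightarrow> knowledge) \<Rightarrow> (knowledge list \<Rightarrow> point) \<Rightarrow> point \<Rightarrow> point \<Rightarrow> nat \<Rightarrow> point list" where
  "visited K f s t 0 = [s]"
| "visited K f s t (Suc k) =
     (let xs = visited K f s t k; h = map K xs
      in xs @ [if last xs = t then t else if known_contacts h = {} then last xs else f h])"

definition hops :: "(nat \<Rightarrow> point) \<Rightarrow> point \<Rightarrow> enat" where
  "hops x t = (if \<exists>k. x k = t then enat (LEAST k. x k = t) else \<infinity>)"


subsection \<open>The whole experiment\<close>

text \<open>
  If \<open>v\<close> is uniform on \<open>[0, 1)\<close> and \<open>N > 0\<close>, then \<open>\<lfloor>v N\<rfloor>\<close> is uniform on \<open>{0, \<dots>, N - 1}\<close>.
  Two independent such \<open>v\<close> select the source and the destination. If \<open>N = 0\<close>, which has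
  probability \<open>exp (- n)\<close>, the result is a meaningless point.
\<close>

definition pick :: "('a \<Rightarrow> nat) \<Rightarrow> (nat \<Rightarrow> 'a \<Rightarrow> point) \<Rightarrow> 'a \<Rightarrow> real \<Rightarrow> point" where
  "pick N X \<omega> v = X (nat \<lfloor>v * real (N \<omega>)\<rfloor>) \<omega>"

type_synonym ('a, 'w) outcome = "('a \<times> (nat set \<Rightarrow> real)) \<times> (real \<times> real) \<times> 'w"

text \<open>\<open>Q\<close> is the law of the seed of the routing algorithm.\<close>

definition routing_space :: "'a measure \<Rightarrow> 'w measure \<Rightarrow> ('a, 'w) outcome measure" where
  "routing_space P Q = graph_space P \<Otimes>\<^sub>M
     ((uniform_measure lborel {0..<1} \<Otimes>\<^sub>M uniform_measure lborel {0..<1}) \<Otimes>\<^sub>M Q)"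

definition source :: "('a \<Rightarrow> nat) \<Rightarrow> (nat \<Rightarrow> 'a \<Rightarrow> point) \<Rightarrow> ('a, 'w) outcome \<Rightarrow> point" where
  "source N X = (\<lambda>((\<omega>, u), (v, v'), w). pick N X \<omega> v)"

definition destination :: "('a \<Rightarrow> nat) \<Rightarrow> (nat \<Rightarrow> 'a \<Rightarrow> point) \<Rightarrow> ('a, 'w) outcome \<Rightarrow> point" where
  "destination N X = (\<lambda>((\<omega>, u), (v, v'), w). pick N X \<omega> v')"

text \<open>The node \<open>x\<^sub>k\<close> as a function of the outcome.\<close>

definition route ::
    "real \<Rightarrow> real \<Rightarrow> real \<Rightarrow> nat \<Rightarrow> ('a \<Rightarrow> nat) \<Rightarrow> (nat \<Rightarrow> 'a \<Rightarrow> point) \<Rightarrow> 'w algorithm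
      \<Rightarrow> ('a, 'w) outcome \<Rightarrow> nat \<Rightarrow> point" where
  "route c \<alpha> a n N X A z k =
     (case z of ((\<omega>, u), (v, v'), w) \<Rightarrow>
        last (visited (knowledge c n (points N X \<omega>) (shortcuts c \<alpha> a n N X (\<omega>, u)))
                (A w (destination N X z)) (source N X z) (destination N X z) k))"

end

theory Submission
  imports Defs "HOL-Real_Asymp.Real_Asymp"
begin

text \<open>
  Shortcuts of length about the size of the torus are rare: a given node has one of length more
  than \<open>R\<close> with probability at most of order \<open>a\<^sub>n R\<^bsup>2 - \<alpha>\<^esup>\<close>. A message that makes at
  most \<open>K\<close> hops without ever using an edge longer than \<open>R\<close> stays within \<open>K R\<close> of its source, while
  the destination is typically at a distance of order \<open>\<surd>n\<close>. So the message has to discover a long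
  shortcut at one of the first nodes, which has probability at most of order \<open>K a\<^sub>n R\<^bsup>2 - \<alpha>\<^esup>\<close>.
  With \<open>K = n\<^sup>\<gamma>\<close> and \<open>R = n\<^sup>\<beta>\<close>, and up to the factor \<open>a\<^sub>n\<close>, the two requirements
  \<open>\<gamma> + \<beta> < 1/2\<close> and \<open>\<gamma> < \<beta> (\<alpha> - 2)\<close> can be met exactly
  if \<open>\<gamma> < (\<alpha> - 2) / (2 (\<alpha> - 1))\<close>.

  The nodes visited depend on the shortcuts found, so the union bound over the visited nodes needs an
  argument. It is a coupling: run the same algorithm on the graph from which all shortcuts longer
  than \<open>R\<close> have been removed. As long as none of the nodes visited there has a long shortcut in the
  full graph, both runs see the same and agree (\<open>long_shortcut_if_far_apart\<close>). The nodes visited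
  in the reduced graph are a function of the marks of the short pairs only, hence independent of the
  long shortcuts, and a union bound applies (\<open>prob_reached_le\<close>). This is done for fixed node
  positions, so that it does not matter what the algorithm learns about them.

  Conditioning on the positions requires that the expected number of long shortcuts is small at
  every node at once. By Chernoff bounds for the counts in cells of side at least \<open>R\<close>
  (\<open>prob_not_sparse_cells\<close>), with high probability every ball of radius \<open>L \<ge> R\<close> contains only
  \<open>O(L\<^sup>2)\<close> nodes (\<open>card_torus_ball_le\<close>); the sum over dyadic annuli around a node then converges
  since \<open>\<alpha> > 2\<close> (\<open>sum_powr_outside_ball_le\<close>). The same ball bound shows that source and destination
  are rarely close (\<open>nn_integral_close_le\<close>).

  It remains to bound \<open>a\<^sub>n\<close> by the normalisation of the mean number of shortcuts. All pairs of
  nodes at a distance between the local radius and \<open>a\<^sub>n\<^bsup>1 / \<alpha>\<^esup>\<close> are joined, so if \<open>a\<^sub>n\<close>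
  were at least a positive power of \<open>n\<close>, the mean number of shortcuts would be unbounded
  (\<open>mean_shortcuts_constant_less\<close>). Hence \<open>a\<^sub>n\<close> grows more slowly than every positive power of \<open>n\<close>,
  which the strict inequality for \<open>\<gamma>\<close> absorbs.
\<close>

section \<open>The metric of the torus\<close>

lemma circle_dist_nonneg:
  assumes "x \<in> {0..l}" "y \<in> {0..l}"
  shows "0 \<le> circle_dist l x y"
  using assms by (auto simp: circle_dist_def)

lemma circle_dist_triangle:
  assumes "x \<in> {0..l}" "y \<in> {0..l}" "z \<in> {0..l}"
  shows "circle_dist l x z \<le> circle_dist l x y + circle_dist l y z"
  using assms by (auto simp: circle_dist_def min_def abs_real_def)

lemma circle_dist_commute: "circle_dist l x y = circle_dist l y x"
  by (simp add: circle_dist_def abs_minus_commute)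

lemma torus_dist_commute: "torus_dist n x y = torus_dist n y x"
  by (simp add: torus_dist_def circle_dist_commute)

lemma torus_dist_self:
  assumes "x \<in> square n"
  shows "torus_dist n x x = 0"
  by (simp add: torus_dist_def circle_dist_def)

lemma torus_dist_triangle:
  assumes "x \<in> square n" "y \<in> square n" "z \<in> square n"
  shows "torus_dist n x z \<le> torus_dist n x y + torus_dist n y z"
proof -
  have "fst x \<in> {0..sqrt n}" "snd x \<in> {0..sqrt n}" "fst y \<in> {0..sqrt n}"
    "snd y \<in> {0..sqrt n}" "fst z \<in> {0..sqrt n}" "snd z \<in> {0..sqrt n}"
    using assms by (auto simp: square_def mem_Times_iff)
  define cd where "cd = circle_dist (sqrt n)"
  have "torus_dist n x z
      \<le> sqrt ((cd (fst x) (fst y) + cd (fst y) (fst z))\<^sup>2 + (cd (snd x) (snd y) + cd (snd y) (snd z))\<^sup>2)"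
    unfolding torus_dist_def cd_def
    by (intro real_sqrt_le_mono add_mono power_mono circle_dist_triangle circle_dist_nonneg) fact+
  also have "\<dots> \<le> torus_dist n x y + torus_dist n y z"
    unfolding torus_dist_def cd_def by (rule real_sqrt_sum_squares_triangle_ineq)
  finally show ?thesis .
qed

lemma circle_dist_le_torus_dist:
  "circle_dist (sqrt n) (fst x) (fst y) \<le> torus_dist n x y"
  "circle_dist (sqrt n) (snd x) (snd y) \<le> torus_dist n x y"
  by (simp_all add: torus_dist_def real_le_rsqrt)

lemma torus_dist_le_sqrt:
  assumes "x \<in> square n" "y \<in> square n"
  shows "torus_dist n x y \<le> sqrt n"
proof -
  have *: "(circle_dist (sqrt n) u v)\<^sup>2 \<le> n / 4" if "u \<in> {0..sqrt n}" "v \<in> {0..sqrt n}" for u v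
  proof -
    have "circle_dist (sqrt n) u v \<le> sqrt n / 2" by (auto simp: circle_dist_def min_def)
    then have "(circle_dist (sqrt n) u v)\<^sup>2 \<le> (sqrt n / 2)\<^sup>2"
      using that by (intro power_mono circle_dist_nonneg) auto
    then show ?thesis by (simp add: power_divide)
  qed
  have "(circle_dist (sqrt n) (fst x) (fst y))\<^sup>2 + (circle_dist (sqrt n) (snd x) (snd y))\<^sup>2 \<le> n/4 + n/4"
    using assms by (intro add_mono *) (auto simp: square_def mem_Times_iff)
  also have "\<dots> \<le> n" by simp
  finally show ?thesis unfolding torus_dist_def by (intro real_sqrt_le_mono)
qed

section \<open>Sparse configurations of points\<close>

definition cell :: "real \<Rightarrow> int \<Rightarrow> int \<Rightarrow> point set" where
  "cell b i j = {real_of_int i * b ..< (real_of_int i + 1) * b} \<times> {real_of_int j * b ..< (real_of_int j + 1) * b}"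

lemma mem_cell_iff:
  assumes "b > 0"
  shows "x \<in> cell b i j \<longleftrightarrow> \<lfloor>fst x / b\<rfloor> = i \<and> \<lfloor>snd x / b\<rfloor> = j"
proof -
  have "u \<in> {real_of_int k * b ..< (real_of_int k + 1) * b} \<longleftrightarrow> \<lfloor>u / b\<rfloor> = k" for u k
    using assms by (simp add: floor_eq_iff field_simps)
  then show ?thesis by (auto simp: cell_def mem_Times_iff)
qed

text \<open>
  An arc of the circle may wrap around the end point. Unrolled, it is covered by the intervals of
  radius \<open>b\<close> around \<open>x\<close>, \<open>x - l\<close> and \<open>x + l\<close>, and each of these meets at most three consecutive
  intervals \<open>[k b, (k + 1) b)\<close>.
\<close>

lemma floors_of_arc:
  assumes x: "x \<in> {0..l}" and b: "0 < b"
  obtains I :: "int set" where "finite I" "card I \<le> 9"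
    "\<And>y. y \<in> {0..l} \<Longrightarrow> circle_dist l x y \<le> b \<Longrightarrow> \<lfloor>y / b\<rfloor> \<in> I"
proof -
  define I where "I = (\<Union>z\<in>{x, x - l, x + l}. {\<lfloor>z / b\<rfloor> - 1 .. \<lfloor>z / b\<rfloor> + 1})"
  have fl: "\<lfloor>y / b\<rfloor> \<in> {\<lfloor>z / b\<rfloor> - 1 .. \<lfloor>z / b\<rfloor> + 1}" if "\<bar>y - z\<bar> \<le> b" for y z
  proof -
    have "\<bar>y / b - z / b\<bar> \<le> 1"
      using that b by (simp add: abs_divide flip: diff_divide_distrib)
    then have "y / b \<le> z / b + 1" "z / b - 1 \<le> y / b" by linarith+
    then show ?thesis by (auto simp: le_floor_iff floor_le_iff) linarith+
  qed
  have "card I \<le> (\<Sum>z\<in>{x, x - l, x + l}. card {\<lfloor>z / b\<rfloor> - 1 .. \<lfloor>z / b\<rfloor> + 1})"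
    unfolding I_def by (rule card_UN_le) simp
  also have "\<dots> = 3 * card {x, x - l, x + l}" by simp
  also have "\<dots> \<le> 9" using card_insert_le_m1[of 3 "{x-l,x+l}" x] by (simp add: card_insert_if)
  finally have "card I \<le> 9" .
  moreover have "\<lfloor>y / b\<rfloor> \<in> I" if "y \<in> {0..l}" "circle_dist l x y \<le> b" for y
  proof -
    have "\<bar>y - x\<bar> \<le> b \<or> \<bar>y - (x - l)\<bar> \<le> b \<or> \<bar>y - (x + l)\<bar> \<le> b"
      using that x by (auto simp: circle_dist_def min_def abs_real_def split: if_splits)
    then show ?thesis unfolding I_def using fl by blast
  qed
  ultimately show thesis by (intro that[of I]) (simp_all add: I_def)
qed

text \<open>
  The bound is four times the area of the cell, far enough above the expected number of nodes for an
  exponentially small failure probability. Restricting the sides to multiples of \<open>R\<close> leaves finitely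
  many events for a union bound, and rounding a radius up to such a multiple loses at most a factor
  \<open>2\<close>. If \<open>R \<ge> 1\<close>, the cells with indices up to \<open>n\<close> cover the square.
\<close>

definition sparse_cells :: "nat \<Rightarrow> real \<Rightarrow> point set \<Rightarrow> bool" where
  "sparse_cells n R V \<longleftrightarrow> (\<forall>k\<in>{1..n}. \<forall>i\<in>{..n}. \<forall>j\<in>{..n}.
      real (card (V \<inter> (cell (real k * R) (int i) (int j) \<inter> square n))) \<le> 4 * (real k * R)\<^sup>2)"

text \<open>
  The ball meets at most \<open>9 * 9\<close> cells whose side lies between \<open>L\<close> and \<open>2 L\<close>, each with at most
  \<open>4 (2 L)\<^sup>2\<close> nodes. For \<open>L > n R\<close> there is no such side, but then cells of side \<open>n R\<close> are already
  as large as the whole torus.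
\<close>

lemma card_torus_ball_le:
  assumes V: "finite V" "V \<subseteq> square n" and sparse: "sparse_cells n R V"
    and R: "1 \<le> R" "R \<le> L" and x: "x \<in> square n" and n: "1 \<le> n"
  shows "real (card {y\<in>V. torus_dist n x y \<le> L}) \<le> 1296 * L\<^sup>2"
proof -
  \<comment> \<open>The side of the cells is the smallest multiple of \<open>R\<close> that is at least \<open>L\<close>, or \<open>n R\<close> if this is smaller.\<close>
  define k where "k = min n (nat \<lceil>L / R\<rceil>)"
  define b where "b = real k * R"
  have LR: "1 \<le> L / R" using R by (simp add: field_simps)
  have k: "k \<in> {1..n}" using LR n by (auto simp: k_def) linarith
  have b1: "1 \<le> b" unfolding b_def using k R(1) mult_mono[of 1 "real k" 1 R] by simp
  have bL: "b \<le> 2 * L"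
  proof -
    have "real k \<le> L / R + 1" unfolding k_def using LR by linarith
    also have "\<dots> \<le> 2 * (L / R)" using LR by simp
    finally show ?thesis using R unfolding b_def by (simp add: field_simps)
  qed
  have Lb: "min L (sqrt n) \<le> b"
  proof (cases "n \<le> nat \<lceil>L / R\<rceil>")
    case True
    then have "b = n * R" by (simp add: b_def k_def)
    moreover have "sqrt n \<le> n" using n by (simp add: real_le_lsqrt power2_eq_square)
    moreover have "real n \<le> n * R" using R n by simp
    ultimately show ?thesis by simp
  next
    case False
    then have "real k \<ge> L / R" using LR by (simp add: k_def min_def)
    then show ?thesis using R by (simp add: b_def field_simps min_le_iff_disj)
  qed
  have sq: "fst y \<in> {0..sqrt n}" "snd y \<in> {0..sqrt n}" if "y \<in> square n" for y
    using that by (auto simp: square_def mem_Times_iff)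
  obtain I where I: "finite I" "card I \<le> 9"
    "\<And>y. y \<in> {0..sqrt n} \<Longrightarrow> circle_dist (sqrt n) (fst x) y \<le> b \<Longrightarrow> \<lfloor>y / b\<rfloor> \<in> I"
    using floors_of_arc[of "fst x" "sqrt n" b] sq x b1 by (metis less_le_trans zero_less_one)
  obtain J where J: "finite J" "card J \<le> 9"
    "\<And>y. y \<in> {0..sqrt n} \<Longrightarrow> circle_dist (sqrt n) (snd x) y \<le> b \<Longrightarrow> \<lfloor>y / b\<rfloor> \<in> J"
    using floors_of_arc[of "snd x" "sqrt n" b] sq x b1 by (metis less_le_trans zero_less_one)
  have idx: "\<lfloor>u / b\<rfloor> \<in> {0..int n}" if "u \<in> {0..sqrt n}" for u
  proof -
    have "u / b \<le> u" using that b1 by (simp add: divide_le_eq mult_le_cancel_left1)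
    also have "u \<le> n" using that n order_trans[of u "sqrt n" n]
      by (simp add: real_le_lsqrt power2_eq_square)
    finally show ?thesis using that b1 by (auto simp: floor_le_iff)
  qed
  have cnt: "real (card (V \<inter> (cell b p q \<inter> square n))) \<le> 16 * L\<^sup>2" if "(p, q) \<in> (I \<times> J) \<inter> {0..int n} \<times> {0..int n}" for p q
  proof -
    have "real (card (V \<inter> (cell b (int (nat p)) (int (nat q)) \<inter> square n))) \<le> 4 * b\<^sup>2"
      using sparse[unfolded sparse_cells_def] k that unfolding b_def
      by (elim ballE[of _ _ k] ballE[of _ _ "nat p"] ballE[of _ _ "nat q"]) (auto simp: nat_le_iff)
    also have "b\<^sup>2 \<le> (2 * L)\<^sup>2" using bL b1 by (intro power_mono) auto
    finally show ?thesis using that by (simp add: power_mult_distrib)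
  qed
  have "{y\<in>V. torus_dist n x y \<le> L} \<subseteq> (\<Union>(p, q)\<in>(I \<times> J) \<inter> {0..int n} \<times> {0..int n}. V \<inter> (cell b p q \<inter> square n))"
  proof
    fix y assume "y \<in> {y\<in>V. torus_dist n x y \<le> L}"
    then have y: "y \<in> V" "y \<in> square n" "torus_dist n x y \<le> b"
      using V Lb torus_dist_le_sqrt[OF x, of y] by auto
    have "\<lfloor>fst y / b\<rfloor> \<in> I" "\<lfloor>snd y / b\<rfloor> \<in> J"
      using circle_dist_le_torus_dist[of n x y] y I(3) J(3) sq by (auto intro: order_trans)
    moreover have "y \<in> cell b \<lfloor>fst y / b\<rfloor> \<lfloor>snd y / b\<rfloor>" using b1 by (simp add: mem_cell_iff)
    ultimately show "y \<in> (\<Union>(p, q)\<in>(I \<times> J) \<inter> {0..int n} \<times> {0..int n}. V \<inter> (cell b p q \<inter> square n))"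
      using y idx sq[OF y(2)] by blast
  qed
  then have "card {y\<in>V. torus_dist n x y \<le> L}
      \<le> card (\<Union>(p, q)\<in>(I \<times> J) \<inter> {0..int n} \<times> {0..int n}. V \<inter> (cell b p q \<inter> square n))"
    using V by (intro card_mono) (auto intro: finite_subset)
  also have "\<dots> \<le> (\<Sum>(p, q)\<in>(I \<times> J) \<inter> {0..int n} \<times> {0..int n}. card (V \<inter> (cell b p q \<inter> square n)))"
    using I J by (intro order_trans[OF card_UN_le] sum_mono) auto
  finally have "real (card {y\<in>V. torus_dist n x y \<le> L})
      \<le> (\<Sum>(p, q)\<in>(I \<times> J) \<inter> {0..int n} \<times> {0..int n}. real (card (V \<inter> (cell b p q \<inter> square n))))"
    by (simp add: case_prod_unfold flip: of_nat_sum)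
  also have "\<dots> \<le> real (card ((I \<times> J) \<inter> {0..int n} \<times> {0..int n})) * (16 * L\<^sup>2)"
    using cnt by (intro sum_bounded_above) auto
  also have "\<dots> \<le> 81 * (16 * L\<^sup>2)"
  proof (intro mult_right_mono)
    have "card ((I \<times> J) \<inter> {0..int n} \<times> {0..int n}) \<le> card (I \<times> J)"
      using I J by (intro card_mono) auto
    also have "\<dots> \<le> 9 * 9" using I J by (simp only: card_cartesian_product mult_le_mono)
    finally show "real (card ((I \<times> J) \<inter> {0..int n} \<times> {0..int n})) \<le> 81" by simp
  qed simp
  finally show ?thesis by simp
qed

text \<open>
  The annulus between the radii \<open>2\<^sup>k R\<close> and \<open>2\<^bsup>k + 1\<^esup> R\<close> has at most \<open>4 C (2\<^sup>k R)\<^sup>2\<close> nodes, each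
  contributing at most \<open>(2\<^sup>k R)\<^bsup>- \<alpha>\<^esup>\<close>. These bounds form a geometric series with ratio
  \<open>2\<^bsup>2 - \<alpha>\<^esup> < 1\<close>.
\<close>

lemma sum_powr_outside_ball_le:
  assumes V: "finite V" "V \<subseteq> square n" "x \<in> square n" and R: "0 < R" and \<alpha>: "2 < \<alpha>" and C: "0 \<le> C"
    and ball: "\<And>L. R \<le> L \<Longrightarrow> real (card {y\<in>V. torus_dist n x y \<le> L}) \<le> C * L\<^sup>2"
  shows "(\<Sum>y | y \<in> V \<and> R < torus_dist n x y. torus_dist n x y powr (-\<alpha>))
     \<le> 4 * C / (1 - 2 powr (2 - \<alpha>)) * R powr (2 - \<alpha>)"
proof -
  define q where "q = 2 powr (2 - \<alpha>)"
  have q: "0 < q" "q < 1" using \<alpha> by (auto simp: q_def powr_less_one)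
  have step: "(\<Sum>y | y \<in> V \<and> R < torus_dist n x y \<and> torus_dist n x y \<le> 2 ^ m * R. torus_dist n x y powr (-\<alpha>))
     \<le> 4 * C * R powr (2 - \<alpha>) * (\<Sum>k<m. q ^ k)" for m
  proof (induction m)
    case 0
    have "{y. y \<in> V \<and> R < torus_dist n x y \<and> torus_dist n x y \<le> 2 ^ 0 * R} = {}" by auto
    then show ?case by (simp only:) simp
  next
    case (Suc m)
    let ?d = "torus_dist n x" let ?L = "2 ^ m * R"
    have "(\<Sum>y | y \<in> V \<and> R < ?d y \<and> ?d y \<le> 2 ^ Suc m * R. ?d y powr (-\<alpha>))
       \<le> (\<Sum>y \<in> {y. y \<in> V \<and> R < ?d y \<and> ?d y \<le> 2 ^ m * R} \<union> {y\<in>V. ?L < ?d y \<and> ?d y \<le> 2 * ?L}. ?d y powr (-\<alpha>))"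
      using V by (intro sum_mono2) auto
    also have "\<dots> = (\<Sum>y | y \<in> V \<and> R < ?d y \<and> ?d y \<le> 2 ^ m * R. ?d y powr (-\<alpha>))
        + (\<Sum>y | y \<in> V \<and> ?L < ?d y \<and> ?d y \<le> 2 * ?L. ?d y powr (-\<alpha>))"
      using V by (intro sum.union_disjoint) auto
    also have "(\<Sum>y | y \<in> V \<and> ?L < ?d y \<and> ?d y \<le> 2 * ?L. ?d y powr (-\<alpha>))
        \<le> real (card {y. y \<in> V \<and> ?L < ?d y \<and> ?d y \<le> 2 * ?L}) * ?L powr (-\<alpha>)"
      using R \<alpha> by (intro sum_bounded_above powr_mono2') auto
    also have "\<dots> \<le> (C * (2 * ?L)\<^sup>2) * ?L powr (-\<alpha>)"
    proof (intro mult_right_mono)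
      have "card {y. y \<in> V \<and> ?L < ?d y \<and> ?d y \<le> 2 * ?L} \<le> card {y\<in>V. ?d y \<le> 2 * ?L}"
        using V by (intro card_mono) auto
      moreover have "1 * R \<le> (2 * 2 ^ m) * R"
        using R one_le_power[of "2::real" m] by (intro mult_right_mono) linarith+
      ultimately show "real (card {y. y \<in> V \<and> ?L < ?d y \<and> ?d y \<le> 2 * ?L}) \<le> C * (2 * ?L)\<^sup>2"
        using ball[of "2 * ?L"] by (simp add: mult.assoc)
    qed simp
    also have "\<dots> = 4 * C * R powr (2 - \<alpha>) * q ^ m"
    proof -
      have "?L powr 2 = ?L\<^sup>2" using R by (subst powr_numeral) auto
      then have "?L\<^sup>2 * ?L powr (-\<alpha>) = ?L powr (2 - \<alpha>)" by (simp add: powr_diff powr_minus divide_inverse)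
      also have "\<dots> = (2 ^ m) powr (2 - \<alpha>) * R powr (2 - \<alpha>)" using R by (simp add: powr_mult)
      also have "(2 ^ m) powr (2 - \<alpha>) = q ^ m"
        by (simp add: q_def powr_powr mult.commute flip: powr_realpow)
      finally have *: "?L\<^sup>2 * ?L powr (-\<alpha>) = q ^ m * R powr (2 - \<alpha>)" .
      have "(C * (2 * ?L)\<^sup>2) * ?L powr (-\<alpha>) = 4 * C * (?L\<^sup>2 * ?L powr (-\<alpha>))"
        by (simp add: power_mult_distrib)
      then show ?thesis by (simp only: *) simp
    qed
    finally show ?case using Suc by (simp add: distrib_left algebra_simps)
  qed
  obtain m where m: "sqrt n / R < 2 ^ m" using real_arch_pow[of 2] by auto
  have "{y. y \<in> V \<and> R < torus_dist n x y}
      = {y. y \<in> V \<and> R < torus_dist n x y \<and> torus_dist n x y \<le> 2 ^ m * R}"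
  proof -
    have "sqrt n \<le> 2 ^ m * R" using m R by (simp add: field_simps)
    then have "torus_dist n x y \<le> 2 ^ m * R" if "y \<in> V" for y
      using torus_dist_le_sqrt[of x n y] that V by auto
    then show ?thesis by blast
  qed
  then have "(\<Sum>y | y \<in> V \<and> R < torus_dist n x y. torus_dist n x y powr (-\<alpha>))
      \<le> 4 * C * R powr (2 - \<alpha>) * (\<Sum>k<m. q ^ k)"
    using step[of m] by simp
  also have "\<dots> \<le> 4 * C * R powr (2 - \<alpha>) * (1 / (1 - q))"
    using q sum_le_suminf[of "\<lambda>k. q ^ k" "{..<m}"] C
    by (intro mult_left_mono) (simp_all add: suminf_geometric)
  finally show ?thesis by (simp add: q_def)
qed

section \<open>Routes that use short edges only\<close>

lemma length_visited [simp]: "length (visited K f s t k) = Suc k"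
  by (induction k) (simp_all add: Let_def)

lemma last_visited_eq_destination:
  assumes "last (visited K f s t k) = t" "k \<le> m"
  shows "last (visited K f s t m) = t"
  using assms(2,1) by (induction rule: dec_induct) (simp_all add: Let_def)

lemma set_visited_mono: "k \<le> m \<Longrightarrow> set (visited K f s t k) \<subseteq> set (visited K f s t m)"
  by (induction rule: dec_induct) (auto simp: Let_def)

text \<open>
  The algorithm only sees what the visited nodes know, so two graphs give the same route if they look
  alike from the nodes visited in one of them.
\<close>

lemma visited_cong:
  assumes "\<And>x. x \<in> set (visited K' f s t k) \<Longrightarrow> K x = K' x"
  shows "visited K f s t k = visited K' f s t k"
  using assms
proof (induction k)
  case (Suc k)
  then have "visited K f s t k = visited K' f s t k"
    using set_visited_mono[of k "Suc k" K' f s t] by (auto simp: Let_def)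
  moreover have "map K (visited K' f s t k) = map K' (visited K' f s t k)"
    using Suc.prems by (intro map_cong) (auto simp: Let_def)
  ultimately show ?case by (simp add: Let_def del: map_eq_conv)
qed simp

text \<open>
  A new node is a contact of some visited node, not necessarily of the latest one. Hence the distance
  of the furthest visited node from \<open>s\<close> grows by at most \<open>R\<close> per hop.
\<close>

lemma torus_dist_visited_le:
  assumes V: "V \<subseteq> square n" "s \<in> V" "t \<in> V" and R: "0 \<le> R" "local_radius c n \<le> R"
    and E: "\<And>x y. (x, y) \<in> E \<Longrightarrow> y \<in> V \<and> torus_dist n x y \<le> R"
    and f: "\<And>h. known_contacts h \<noteq> {} \<Longrightarrow> f h \<in> known_contacts h"
    and x: "x \<in> set (visited (knowledge c n V E) f s t k)"
  shows "x \<in> V \<and> (torus_dist n s x \<le> real k * R)"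
  using x
proof (induction k arbitrary: x)
  case 0
  then show ?case using V by (auto simp: torus_dist_self)
next
  case (Suc k)
  let ?xs = "visited (knowledge c n V E) f s t k"
  let ?h = "map (knowledge c n V E) ?xs"
  have old: "y \<in> V \<and> torus_dist n s y \<le> real (Suc k) * R" if "y \<in> set ?xs" for y
    using Suc.IH[OF that] R by (auto simp: distrib_right)
  have last: "last ?xs \<in> set ?xs" using length_visited[of _ f s t k] by (intro last_in_set) (metis length_0_conv nat.distinct(1))
  show ?case
  proof (cases "x \<in> set ?xs")
    case False
    then have "x = f ?h" "known_contacts ?h \<noteq> {}"
      using Suc.prems last by (auto simp: Let_def split: if_splits)
    then have "x \<in> known_contacts ?h" using f by blast
    then obtain y where y: "y \<in> set ?xs" and "x \<in> local_contacts c n V y \<union> shortcut_contacts E y"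
      by (auto simp: known_contacts_def knowledge_def)
    then have "x \<in> V" "torus_dist n y x \<le> R"
      using E[of y x] R by (auto simp: local_contacts_def shortcut_contacts_def)
    moreover have "y \<in> V" "torus_dist n s y \<le> real k * R" using Suc.IH[OF y] by auto
    ultimately show ?thesis
      using torus_dist_triangle[of s n y x] V by (fastforce simp: distrib_right)
  qed (use old in blast)
qed

text \<open>
  The coupling with the graph \<open>E'\<close> that lacks the long shortcuts. If no node on the route in \<open>E'\<close> had
  a long shortcut in \<open>E\<close>, the two routes would agree, and the message would not have got further than
  \<open>k R\<close>. The point of the conclusion is that the route mentioned in it is determined by \<open>E'\<close>.
\<close>

lemma long_shortcut_if_far_apart:
  assumes V: "V \<subseteq> square n" "s \<in> V" "t \<in> V" and R: "0 \<le> R" "local_radius c n \<le> R"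
    and E: "\<And>x y. (x, y) \<in> E \<Longrightarrow> y \<in> V"
    and f: "\<And>h. known_contacts h \<noteq> {} \<Longrightarrow> f h \<in> known_contacts h"
    and E': "E' = {(x, y) \<in> E. torus_dist n x y \<le> R}"
    and reached: "last (visited (knowledge c n V E) f s t k) = t"
    and far: "real k * R < torus_dist n s t"
  shows "\<exists>x\<in>set (visited (knowledge c n V E') f s t k). \<exists>y. (x, y) \<in> E \<and> R < torus_dist n x y"
proof (rule ccontr)
  assume *: "\<not> ?thesis"
  have eq: "visited (knowledge c n V E) f s t k = visited (knowledge c n V E') f s t k"
  proof (rule visited_cong)
    fix x assume "x \<in> set (visited (knowledge c n V E') f s t k)"
    with * have "shortcut_contacts E x = shortcut_contacts E' x"
      by (force simp: shortcut_contacts_def E')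
    then show "knowledge c n V E x = knowledge c n V E' x" by (simp add: knowledge_def)
  qed
  have "last (visited (knowledge c n V E') f s t k) \<in> set (visited (knowledge c n V E') f s t k)"
    using length_visited[of "knowledge c n V E'" f s t k] by (intro last_in_set) (metis length_0_conv nat.distinct(1))
  then have "t \<in> set (visited (knowledge c n V E') f s t k)" using reached eq by simp
  moreover have "y \<in> V \<and> torus_dist n x y \<le> R" if "(x, y) \<in> E'" for x y
    using that E[of x y] unfolding E' by simp
  ultimately have "torus_dist n s t \<le> real k * R"
    using torus_dist_visited_le[where E=E' and c=c and f=f and k=k] V R f by blast
  with far show False by simp
qed

section \<open>Edge marks\<close>

lemma prob_space_mark: "prob_space (uniform_measure lborel {0..1::real})"
  by (rule prob_space_uniform_measure) simp_all

lemma prob_space_edge_marks: "prob_space edge_marks"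
  unfolding edge_marks_def by (intro prob_space_PiM prob_space_mark)

lemma measurable_mark:
  assumes "card e = 2"
  shows "(\<lambda>u. u e) \<in> borel_measurable edge_marks"
proof -
  have "(\<lambda>u. u e) \<in> measurable edge_marks (uniform_measure lborel {0..1})"
    unfolding edge_marks_def using assms by (intro measurable_component_singleton) simp
  then show ?thesis by (simp cong: measurable_cong_sets)
qed

lemma distr_mark:
  assumes "card e = 2"
  shows "distr edge_marks borel (\<lambda>u. u e) = uniform_measure lborel {0..1}"
proof -
  have "distr edge_marks (uniform_measure lborel {0..1}) (\<lambda>u. u e) = uniform_measure lborel {0..1}"
    unfolding edge_marks_def using assms
    by (intro distr_PiM_component prob_space_mark) simp
  moreover have "distr edge_marks (uniform_measure lborel {0..1}) (\<lambda>u. u e) = distr edge_marks borel (\<lambda>u. u e)"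
    by (intro distr_cong) auto
  ultimately show ?thesis by simp
qed

lemma prob_mark_less_le:
  assumes "card e = 2"
  shows "measure edge_marks {u\<in>space edge_marks. u e < p} \<le> max 0 p"
proof -
  have "measure edge_marks {u\<in>space edge_marks. u e < p} = measure (distr edge_marks borel (\<lambda>u. u e)) {..<p}"
    using measurable_mark[OF assms]
    by (subst measure_distr) (auto intro!: arg_cong[where f="measure _"])
  also have "\<dots> = measure lborel ({0..1} \<inter> {..<p})"
    unfolding distr_mark[OF assms] by (subst measure_uniform_measure) simp_all
  also have "\<dots> \<le> measure lborel {0..max 0 p}"
    by (rule measure_mono_fmeasurable) (auto simp: fmeasurable_def)
  finally show ?thesis by simp
qed

lemma AE_mark_less_1:
  assumes "card e = 2"
  shows "AE u in edge_marks. u e < 1"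
proof -
  have "AE x in uniform_measure lborel {0..1::real}. x < 1"
  proof (rule AE_uniform_measureI)
    show "AE x in lborel. x \<in> {0..1} \<longrightarrow> x < (1::real)"
      using AE_lborel_singleton[of "1::real"] by eventually_elim auto
  qed simp
  then have "AE x in distr edge_marks borel (\<lambda>u. u e). x < 1" unfolding distr_mark[OF assms] .
  then show ?thesis using measurable_mark[OF assms] by (subst (asm) AE_distr_iff) auto
qed

lemma indep_marks:
  "prob_space.indep_vars edge_marks (\<lambda>_. uniform_measure lborel {0..1}) (\<lambda>e u. u e) {e. card e = 2}"
proof -
  interpret prob_space edge_marks by (rule prob_space_edge_marks)
  let ?I = "{e :: nat set. card e = 2}"
  let ?M = "\<lambda>_ :: nat set. uniform_measure lborel {0..1::real}"
  have ne: "?I \<noteq> {}" by (auto intro!: exI[of _ "{0, 1}"])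
  have "distr edge_marks (PiM ?I ?M) (\<lambda>u. restrict (\<lambda>e. u e) ?I) = distr (PiM ?I ?M) (PiM ?I ?M) (\<lambda>u. u)"
    unfolding edge_marks_def by (intro distr_cong) (auto simp: space_PiM)
  also have "\<dots> = PiM ?I ?M" by simp
  also have "\<dots> = PiM ?I (\<lambda>e. distr edge_marks (?M e) (\<lambda>u. u e))"
    unfolding edge_marks_def
    by (intro PiM_cong refl distr_PiM_component[symmetric] prob_space_mark) simp
  finally show ?thesis
    by (subst indep_vars_iff_distr_eq_PiM'[OF ne]) (simp_all add: edge_marks_def)
qed

lemma prob_marks_indep:
  assumes S: "S \<subseteq> {e. card e = 2}" and e: "card e = 2" "e \<notin> S"
    and B: "B \<in> sets (PiM S (\<lambda>_. uniform_measure lborel {0..1}))"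
  shows "measure edge_marks {u\<in>space edge_marks. restrict u S \<in> B \<and> u e < p}
    = measure edge_marks {u\<in>space edge_marks. restrict u S \<in> B} * measure edge_marks {u\<in>space edge_marks. u e < p}"
proof -
  interpret prob_space edge_marks by (rule prob_space_edge_marks)
  let ?M = "\<lambda>_ :: nat set. uniform_measure lborel {0..1::real}"
  define C where "C = {v\<in>space (PiM {e} ?M). v e < p}"
  have C: "C \<in> sets (PiM {e} ?M)"
  proof -
    have "(\<lambda>v. v e) \<in> measurable (PiM {e} ?M) (uniform_measure lborel {0..1})"
      by (intro measurable_component_singleton) simp
    then have "(\<lambda>v. v e) \<in> borel_measurable (PiM {e} ?M)" by (simp cong: measurable_cong_sets)
    then show ?thesis unfolding C_def by measurable
  qed
  have "indep_var (PiM S ?M) (\<lambda>u. restrict (\<lambda>e. u e) S) (PiM {e} ?M) (\<lambda>u. restrict (\<lambda>e. u e) {e})"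
    using indep_marks S e by (intro indep_var_restrict) auto
  note indep_varD[OF this B C]
  moreover have "(\<lambda>u. restrict (\<lambda>e. u e) {e}) -` C \<inter> space edge_marks = {u\<in>space edge_marks. u e < p}"
    by (auto simp: C_def space_PiM)
  moreover have "(\<lambda>u. restrict (\<lambda>e. u e) S) -` B \<inter> space edge_marks = {u\<in>space edge_marks. restrict u S \<in> B}"
    by auto
  moreover have "(\<lambda>u. (restrict (\<lambda>e. u e) S, restrict (\<lambda>e. u e) {e})) -` (B \<times> C) \<inter> space edge_marks
      = {u\<in>space edge_marks. restrict u S \<in> B \<and> u e < p}"
    by (auto simp: C_def space_PiM)
  ultimately show ?thesis by simp
qed

lemma finite_points: "finite (points N X \<omega>)"
  by (simp add: points_def)

lemma shortcuts_subset: "shortcuts c \<alpha> a n N X (\<omega>, u) \<subseteq> points N X \<omega> \<times> points N X \<omega>"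
  by (auto simp: shortcuts_def points_def)

lemma mem_shortcuts_iff:
  assumes "inj_on (\<lambda>i. X i \<omega>) {..<N \<omega>}" "i < N \<omega>" "j < N \<omega>"
  shows "(X i \<omega>, X j \<omega>) \<in> shortcuts c \<alpha> a n N X (\<omega>, u) \<longleftrightarrow>
     i \<noteq> j \<and> local_radius c n < torus_dist n (X i \<omega>) (X j \<omega>) \<and>
     u {i, j} < min (a * torus_dist n (X i \<omega>) (X j \<omega>) powr (- \<alpha>)) 1"
  using assms by (auto simp: shortcuts_def inj_on_def)

text \<open>
  For fixed positions of the nodes, the nodes visited along short edges are determined by the marks
  of the short pairs, which are independent of the marks of the long pairs. So the probability that a
  node is visited in this way and has a given long shortcut is a product, and the sum over all these
  events, whose union is \<open>B\<close>, is at most \<open>\<Lambda>\<close> times the expected number of nodes visited.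
\<close>

lemma prob_reached_le:
  fixes N :: "'a \<Rightarrow> nat" and X :: "nat \<Rightarrow> 'a \<Rightarrow> point"
  assumes inj: "inj_on (\<lambda>i. X i \<omega>) {..<N \<omega>}" and V: "points N X \<omega> \<subseteq> square n"
    and st: "s \<in> points N X \<omega>" "t \<in> points N X \<omega>"
    and R: "0 \<le> R" "local_radius c n \<le> R"
    and f: "\<And>h. known_contacts h \<noteq> {} \<Longrightarrow> f h \<in> known_contacts h"
    and far: "real k * R < torus_dist n s t"
    and tail: "\<And>x. x \<in> points N X \<omega> \<Longrightarrow>
       (\<Sum>y | y \<in> points N X \<omega> \<and> R < torus_dist n x y. max 0 (a * torus_dist n x y powr (- \<alpha>))) \<le> \<Lambda>"
  obtains B where "B \<in> sets edge_marks"
    "{u\<in>space edge_marks. last (visited (knowledge c n (points N X \<omega>) (shortcuts c \<alpha> a n N X (\<omega>, u))) f s t k) = t} \<subseteq> B"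
    "measure edge_marks B \<le> real (Suc k) * \<Lambda>"
proof -
  interpret prob_space edge_marks by (rule prob_space_edge_marks)
  define V where "V = points N X \<omega>"
  define E where "E u = shortcuts c \<alpha> a n N X (\<omega>, u)" for u
  define E' where "E' u = {(x, y) \<in> E u. torus_dist n x y \<le> R}" for u
  define vis where "vis u = set (visited (knowledge c n V (E' u)) f s t k)" for u
  define d where "d i j = torus_dist n (X i \<omega>) (X j \<omega>)" for i j
  define p where "p i j = max 0 (a * d i j powr (- \<alpha>))" for i j
  define S where "S = {{i, j} | i j. i < N \<omega> \<and> j < N \<omega> \<and> i \<noteq> j \<and> d i j \<le> R}"
  define J where "J i = {j. j < N \<omega> \<and> j \<noteq> i \<and> R < d i j}" for i
  let ?M = "\<lambda>_ :: nat set. uniform_measure lborel {0..1::real}"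
  have S: "S \<subseteq> {e. card e = 2}" "finite S"
  proof -
    show "S \<subseteq> {e. card e = 2}" by (auto simp: S_def card_insert_if)
    have "S \<subseteq> (\<lambda>(i, j). {i, j}) ` ({..<N \<omega>} \<times> {..<N \<omega>})" by (auto simp: S_def)
    then show "finite S" by (rule finite_subset) simp
  qed
  have d_sym: "d i j = d j i" for i j by (simp add: d_def torus_dist_commute)
  have J_S: "{i, j} \<notin> S" if "j \<in> J i" for i j
    using that d_sym by (auto simp: J_def S_def doubleton_eq_iff)
  have finV: "finite V" by (simp add: V_def finite_points)
  have E'_sub: "E' u \<subseteq> V \<times> V" for u
    using shortcuts_subset[of c \<alpha> a n N X \<omega> u] unfolding E'_def E_def V_def by blast
  have memE': "(X i \<omega>, X j \<omega>) \<in> E' u \<longleftrightarrow>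
      i \<noteq> j \<and> local_radius c n < d i j \<and> d i j \<le> R \<and> u {i, j} < min (a * d i j powr (- \<alpha>)) 1"
    if "i < N \<omega>" "j < N \<omega>" for i j u
    using that by (auto simp: E'_def E_def mem_shortcuts_iff[where X=X and N=N and \<omega>=\<omega>, OF inj] d_def)
  \<comment> \<open>The short edges, hence the nodes visited along them, are determined by the marks of the short pairs.\<close>
  have E'_restrict: "E' (restrict u S) = E' u" for u
  proof -
    have "(X i \<omega>, X j \<omega>) \<in> E' (restrict u S) \<longleftrightarrow> (X i \<omega>, X j \<omega>) \<in> E' u" if "i < N \<omega>" "j < N \<omega>" for i j
      using that by (auto simp: memE' S_def)
    then have "q \<in> E' (restrict u S) \<longleftrightarrow> q \<in> E' u" if "q \<in> V \<times> V" for q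
      using that by (auto simp: V_def points_def)
    then show ?thesis using E'_sub by blast
  qed
  \<comment> \<open>As \<open>E'\<close> has finitely many values, every function of it is measurable, in particular the route for an arbitrary \<open>f\<close>.\<close>
  have meas: "E' \<in> measurable (PiM S ?M) (count_space (Pow (V \<times> V)))"
  proof (subst measurable_count_space_eq2)
    show "finite (Pow (V \<times> V))" using finV by simp
    have comp: "{u\<in>space (PiM S ?M). q \<in> E' u} \<in> sets (PiM S ?M)" if q: "q \<in> V \<times> V" for q
    proof -
      obtain i j where ij: "i < N \<omega>" "j < N \<omega>" "q = (X i \<omega>, X j \<omega>)" using q by (auto simp: V_def points_def)
      show ?thesis
      proof (cases "i \<noteq> j \<and> local_radius c n < d i j \<and> d i j \<le> R")
        case True
        then have "{i, j} \<in> S" using ij by (auto simp: S_def)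
        then have "(\<lambda>u. u {i, j}) \<in> measurable (PiM S ?M) (uniform_measure lborel {0..1})"
          by (intro measurable_component_singleton)
        then have "(\<lambda>u. u {i, j}) \<in> borel_measurable (PiM S ?M)" by (simp cong: measurable_cong_sets)
        then have "{u\<in>space (PiM S ?M). u {i, j} < min (a * d i j powr (- \<alpha>)) 1} \<in> sets (PiM S ?M)"
          by measurable
        then show ?thesis unfolding ij(3) memE'[OF ij(1,2)] by (simp only: True simp_thms)
      next
        case False
        then have "q \<notin> E' u" for u using ij memE' by auto
        then show ?thesis by simp
      qed
    qed
    have "E' -` {F} \<inter> space (PiM S ?M) \<in> sets (PiM S ?M)" if F: "F \<in> Pow (V \<times> V)" for F
    proof -
      have "E' u = F \<longleftrightarrow> (\<forall>q\<in>V \<times> V. q \<in> E' u \<longleftrightarrow> q \<in> F)" for u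
        using F E'_sub[of u] by blast
      then have "E' -` {F} \<inter> space (PiM S ?M) = {u\<in>space (PiM S ?M). \<forall>q\<in>V \<times> V. q \<in> E' u \<longleftrightarrow> q \<in> F}"
        by blast
      also have "\<dots> \<in> sets (PiM S ?M)"
      proof (rule sets.sets_Collect_finite_All)
        fix q assume q: "q \<in> V \<times> V"
        show "{u\<in>space (PiM S ?M). q \<in> E' u \<longleftrightarrow> q \<in> F} \<in> sets (PiM S ?M)"
          using comp[OF q] sets.sets_Collect_neg[OF comp[OF q]] by (cases "q \<in> F") simp_all
      qed (use finV in simp)
      finally show ?thesis .
    qed
    then show "E' \<in> space (PiM S ?M) \<rightarrow> Pow (V \<times> V) \<and>
       (\<forall>F\<in>Pow (V \<times> V). E' -` {F} \<inter> space (PiM S ?M) \<in> sets (PiM S ?M))"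
      using E'_sub by auto
  qed
  define W where "W i = {u\<in>space (PiM S ?M). X i \<omega> \<in> vis u}" for i
  have W: "W i \<in> sets (PiM S ?M)" for i
  proof -
    have "W i = E' -` {F\<in>Pow (V \<times> V). X i \<omega> \<in> set (visited (knowledge c n V F) f s t k)} \<inter> space (PiM S ?M)"
      using E'_sub by (auto simp: W_def vis_def)
    also have "\<dots> \<in> sets (PiM S ?M)" by (rule measurable_sets[OF meas]) auto
    finally show ?thesis .
  qed
  have restr: "(\<lambda>u. restrict u S) \<in> measurable edge_marks (PiM S ?M)"
    unfolding edge_marks_def using S by (intro measurable_restrict_subset) auto
  have W_iff: "restrict u S \<in> W i \<longleftrightarrow> X i \<omega> \<in> vis u" if "u \<in> space edge_marks" for u i
    using that measurable_space[OF restr that] by (simp add: W_def vis_def E'_restrict)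
  define Z where "Z i = {u\<in>space edge_marks. restrict u S \<in> W i}" for i
  have Z: "Z i \<in> events" for i
  proof -
    have "Z i = (\<lambda>u. restrict u S) -` W i \<inter> space edge_marks" by (auto simp: Z_def)
    then show ?thesis using measurable_sets[OF restr W] by simp
  qed
  \<comment> \<open>Some visited node \<open>i\<close> has a long shortcut, to \<open>j\<close>.\<close>
  define B where "B = (\<Union>i\<in>{..<N \<omega>}. \<Union>j\<in>J i. {u\<in>space edge_marks. restrict u S \<in> W i \<and> u {i, j} < p i j})"
  have ev: "{u\<in>space edge_marks. restrict u S \<in> W i \<and> u {i, j} < p i j} \<in> events" if "j \<in> J i" for i j
  proof -
    have [measurable]: "(\<lambda>u. u {i, j}) \<in> borel_measurable edge_marks"
      using that by (intro measurable_mark) (auto simp: J_def)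
    have "{u\<in>space edge_marks. restrict u S \<in> W i \<and> u {i, j} < p i j} = Z i \<inter> {u\<in>space edge_marks. u {i, j} < p i j}"
      by (auto simp: Z_def)
    then show ?thesis using Z by simp
  qed
  have finJ: "finite (J i)" for i by (simp add: J_def)
  have B: "B \<in> events"
    unfolding B_def using ev finJ by (intro sets.finite_UN) auto
  have sub: "{u\<in>space edge_marks. last (visited (knowledge c n V (E u)) f s t k) = t} \<subseteq> B"
  proof
    fix u assume u: "u \<in> {u\<in>space edge_marks. last (visited (knowledge c n V (E u)) f s t k) = t}"
    have "\<exists>x\<in>vis u. \<exists>y. (x, y) \<in> E u \<and> R < torus_dist n x y"
      unfolding vis_def
    proof (rule long_shortcut_if_far_apart[OF _ _ _ R _ f E'_def _ far])
      show "V \<subseteq> square n" "s \<in> V" "t \<in> V" using V st by (simp_all add: V_def)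
      show "y \<in> V" if "(x, y) \<in> E u" for x y
        using that shortcuts_subset[of c \<alpha> a n N X \<omega> u] unfolding E_def V_def by blast
    qed (use u in auto)
    then obtain x y where xy: "x \<in> vis u" "(x, y) \<in> E u" "R < torus_dist n x y" by blast
    then have "(x, y) \<in> V \<times> V" using shortcuts_subset[of c \<alpha> a n N X \<omega> u] unfolding E_def V_def by blast
    then obtain i j where ij: "i < N \<omega>" "j < N \<omega>" "x = X i \<omega>" "y = X j \<omega>"
      by (auto simp: V_def points_def)
    then have "i \<noteq> j" "u {i, j} < p i j"
      using xy mem_shortcuts_iff[where X=X and N=N and \<omega>=\<omega>, OF inj] by (auto simp: E_def p_def d_def)
    moreover have "restrict u S \<in> W i" using xy u ij by (simp add: W_iff)
    ultimately show "u \<in> B" using ij xy u by (auto simp: B_def J_def d_def)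
  qed
  have int: "integrable edge_marks (indicator (Z i) :: _ \<Rightarrow> real)" for i
    using Z[of i] by (intro integrable_const_bound[where B=1]) (auto simp: indicator_def)
  have "prob B \<le> (\<Sum>i<N \<omega>. \<Sum>j\<in>J i. prob {u\<in>space edge_marks. restrict u S \<in> W i \<and> u {i, j} < p i j})"
    unfolding B_def using ev finJ
    by (intro order_trans[OF finite_measure_subadditive_finite] sum_mono) auto
  also have "\<dots> \<le> (\<Sum>i<N \<omega>. \<Sum>j\<in>J i. prob (Z i) * p i j)"
  proof (intro sum_mono)
    fix i j assume "i \<in> {..<N \<omega>}" and j: "j \<in> J i"
    have c2: "card {i, j} = 2" using j by (auto simp: J_def)
    have "prob {u\<in>space edge_marks. u {i, j} < p i j} \<le> p i j"
      using prob_mark_less_le[OF c2, of "p i j"] by (simp add: p_def)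
    then show "prob {u\<in>space edge_marks. restrict u S \<in> W i \<and> u {i, j} < p i j} \<le> prob (Z i) * p i j"
      unfolding prob_marks_indep[OF S(1) c2 J_S[OF j] W] Z_def by (intro mult_left_mono) simp_all
  qed
  also have "\<dots> \<le> (\<Sum>i<N \<omega>. prob (Z i) * \<Lambda>)"
  proof (intro sum_mono)
    fix i assume i: "i \<in> {..<N \<omega>}"
    have "(\<Sum>j\<in>J i. p i j) = (\<Sum>y\<in>(\<lambda>j. X j \<omega>) ` J i. max 0 (a * torus_dist n (X i \<omega>) y powr (- \<alpha>)))"
      by (subst sum.reindex) (auto simp: p_def d_def J_def intro!: inj_on_subset[OF inj])
    also have "\<dots> \<le> (\<Sum>y | y \<in> points N X \<omega> \<and> R < torus_dist n (X i \<omega>) y. max 0 (a * torus_dist n (X i \<omega>) y powr (- \<alpha>)))"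
      using finite_points[of N X \<omega>] by (intro sum_mono2) (auto simp: J_def d_def points_def)
    also have "\<dots> \<le> \<Lambda>" using i by (intro tail) (auto simp: points_def)
    finally show "(\<Sum>j\<in>J i. prob (Z i) * p i j) \<le> prob (Z i) * \<Lambda>"
      by (simp add: mult_left_mono flip: sum_distrib_left)
  qed
  also have "(\<Sum>i<N \<omega>. prob (Z i) * \<Lambda>) = expectation (\<lambda>u. \<Sum>i<N \<omega>. indicator (Z i) u) * \<Lambda>"
    using Z int by (subst Bochner_Integration.integral_sum) (auto simp: sum_distrib_right)
  also have "\<dots> \<le> real (Suc k) * \<Lambda>"
  proof (rule mult_right_mono)
    have "(\<Sum>i<N \<omega>. indicator (Z i) u) \<le> real (Suc k)" if u: "u \<in> space edge_marks" for u
    proof -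
      have "(\<Sum>i<N \<omega>. indicator (Z i) u) = real (card {i\<in>{..<N \<omega>}. X i \<omega> \<in> vis u})"
        using u W_iff[OF u] by (simp add: Z_def indicator_def sum.If_cases Int_def)
      also have "card {i\<in>{..<N \<omega>}. X i \<omega> \<in> vis u} = card ((\<lambda>i. X i \<omega>) ` {i\<in>{..<N \<omega>}. X i \<omega> \<in> vis u})"
        by (rule card_image[symmetric]) (auto intro: inj_on_subset[OF inj])
      also have "\<dots> \<le> card (vis u)" by (rule card_mono) (auto simp: vis_def)
      also have "\<dots> \<le> Suc k" unfolding vis_def by (rule order_trans[OF card_length]) simp
      finally show ?thesis by simp
    qed
    then have "expectation (\<lambda>u. \<Sum>i<N \<omega>. indicator (Z i) u) \<le> expectation (\<lambda>u. real (Suc k))"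
      using int by (intro integral_mono Bochner_Integration.integrable_sum) auto
    then show "expectation (\<lambda>u. \<Sum>i<N \<omega>. indicator (Z i) u) \<le> real (Suc k)"
      by (simp add: prob_space)
    show "0 \<le> \<Lambda>" using order_trans[OF sum_nonneg tail[OF st(1)]] by simp
  qed
  finally show thesis using that[OF B] sub by (simp add: E_def V_def)
qed

section \<open>The Poisson process\<close>

lemma poisson_law_moments:
  assumes "0 \<le> m"
  shows nn_integral_poisson_law_power:
    "0 \<le> z \<Longrightarrow> (\<integral>\<^sup>+k. ennreal (z ^ k) \<partial>measure_pmf (poisson_law m)) = ennreal (exp (m * (z - 1)))"
    and nn_integral_poisson_law_mean:
    "(\<integral>\<^sup>+k. ennreal (real k) \<partial>measure_pmf (poisson_law m)) = ennreal m"
proof -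
  show "(\<integral>\<^sup>+k. ennreal (z ^ k) \<partial>measure_pmf (poisson_law m)) = ennreal (exp (m * (z - 1)))" if z: "0 \<le> z"
  proof (cases "m = 0")
    case False
    have "(\<lambda>k. ((m * z) ^ k /\<^sub>R fact k) * exp (-m)) sums (exp (m * z) * exp (-m))"
      by (intro sums_mult2 exp_converges)
    then have *: "(\<lambda>k. m ^ k / fact k * exp (-m) * z ^ k) sums exp (m * (z - 1))"
      by (simp add: scaleR_conv_of_real power_mult_distrib field_simps flip: exp_add)
    have "(\<integral>\<^sup>+k. ennreal (z ^ k) \<partial>measure_pmf (poisson_law m)) = (\<Sum>k. ennreal (m ^ k / fact k * exp (-m) * z ^ k))"
      using False assms z
      by (simp add: poisson_law_def nn_integral_measure_pmf nn_integral_count_space_nat flip: ennreal_mult)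
    also have "\<dots> = ennreal (exp (m * (z - 1)))"
      using * assms z by (intro suminf_ennreal_eq) auto
    finally show ?thesis .
  qed (simp add: poisson_law_def)
  show "(\<integral>\<^sup>+k. ennreal (real k) \<partial>measure_pmf (poisson_law m)) = ennreal m"
  proof (cases "m = 0")
    case False
    have "(\<lambda>k. m * (m ^ k /\<^sub>R fact k * exp (-m))) sums (m * (exp m * exp (-m)))"
      by (intro sums_mult2 sums_mult exp_converges)
    then have "(\<lambda>k. m ^ Suc k / fact (Suc k) * exp (-m) * real (Suc k)) sums m"
      by (simp add: scaleR_conv_of_real field_simps del: of_nat_Suc flip: exp_add)
    then have *: "(\<lambda>k. m ^ k / fact k * exp (-m) * real k) sums m"
      by (subst (asm) sums_Suc_iff) simp
    have "(\<integral>\<^sup>+k. ennreal (real k) \<partial>measure_pmf (poisson_law m)) = (\<Sum>k. ennreal (m ^ k / fact k * exp (-m) * real k))"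
      using False assms
      by (simp add: poisson_law_def nn_integral_measure_pmf nn_integral_count_space_nat flip: ennreal_mult)
    also have "\<dots> = ennreal m"
      using * assms by (intro suminf_ennreal_eq) auto
    finally show ?thesis .
  qed (simp add: poisson_law_def)
qed

text \<open>
  The Chernoff bound for a Poisson variable, in a form that serves for upper tails (\<open>z > 1\<close>) and for
  lower tails (\<open>z < 1\<close>).
\<close>

lemma poisson_law_markov:
  assumes "0 \<le> m" "0 < z" and A: "\<And>k. k \<in> A \<Longrightarrow> z powr x \<le> z ^ k"
  shows "measure (measure_pmf (poisson_law m)) A \<le> exp (m * (z - 1)) / z powr x"
proof -
  have "emeasure (measure_pmf (poisson_law m)) A \<le> (\<integral>\<^sup>+k. ennreal (z ^ k / z powr x) \<partial>measure_pmf (poisson_law m))"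
  proof -
    have "emeasure (measure_pmf (poisson_law m)) A = (\<integral>\<^sup>+k. indicator A k \<partial>measure_pmf (poisson_law m))" by simp
    also have "\<dots> \<le> (\<integral>\<^sup>+k. ennreal (z ^ k / z powr x) \<partial>measure_pmf (poisson_law m))"
      using A assms by (intro nn_integral_mono) (auto simp: indicator_def)
    finally show ?thesis .
  qed
  also have "\<dots> = ennreal (1 / z powr x) * (\<integral>\<^sup>+k. ennreal (z ^ k) \<partial>measure_pmf (poisson_law m))"
    using assms by (subst nn_integral_cmult[symmetric]) (auto simp flip: ennreal_mult)
  also have "\<dots> = ennreal (exp (m * (z - 1)) / z powr x)"
    using assms by (simp add: nn_integral_poisson_law_power flip: ennreal_mult)
  finally show ?thesis by (simp add: measure_pmf.emeasure_eq_measure)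
qed

lemma poisson_law_upper_tail:
  assumes "0 \<le> m" "m \<le> M"
  shows "measure (measure_pmf (poisson_law m)) {k. 4 * M < real k} \<le> exp (- M)"
proof -
  have "measure (measure_pmf (poisson_law m)) {k. 4 * M < real k} \<le> exp (m * (exp 1 - 1)) / exp 1 powr (4 * M)"
    using assms by (intro poisson_law_markov) (auto simp: powr_def exp_of_nat_mult[symmetric])
  also have "\<dots> = exp (m * (exp 1 - 1) - 4 * M)" by (simp add: powr_def exp_diff)
  also have "m * (exp 1 - 1) \<le> M * (3 - 1)" using assms exp_le by (intro mult_mono) auto
  then have "exp (m * (exp 1 - 1) - 4 * M) \<le> exp (- M)" using assms by simp
  finally show ?thesis .
qed

lemma poisson_law_lower_tail:
  assumes "0 \<le> m"
  shows "measure (measure_pmf (poisson_law m)) {k. real k \<le> m / 4} \<le> exp (- m / 4)"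
proof -
  have "measure (measure_pmf (poisson_law m)) {k. real k \<le> m / 4}
      \<le> exp (m * (exp (-1) - 1)) / exp (-1) powr (m / 4)"
    using assms by (intro poisson_law_markov) (auto simp: powr_def exp_of_nat_mult[symmetric])
  also have "\<dots> = exp (m * (exp (-1) - 1) + m / 4)" by (simp add: powr_def flip: exp_diff)
  also have "exp (-1) \<le> (1/2 :: real)"
    using exp_ge_add_one_self[of 1] by (simp add: exp_minus field_simps)
  then have "m * (exp (-1) - 1) \<le> m * (1/2 - 1)" using assms by (intro mult_left_mono) auto
  then have "exp (m * (exp (-1) - 1) + m / 4) \<le> exp (- m / 4)" by simp
  finally show ?thesis .
qed

lemma emeasure_cell:
  assumes "0 \<le> b"
  shows "emeasure lborel (cell b i j) = ennreal (b\<^sup>2)"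
proof -
  have "emeasure lborel {real_of_int k * b ..< (real_of_int k + 1) * b} = ennreal b" for k
    using assms by (subst emeasure_lborel_Ico) (auto simp: algebra_simps)
  then show ?thesis
    using assms unfolding cell_def lborel_prod[symmetric]
    by (subst lborel.emeasure_pair_measure_Times) (auto simp: power2_eq_square simp flip: ennreal_mult)
qed

lemma cell_borel [measurable]: "cell b i j \<in> sets borel"
  unfolding cell_def borel_prod[symmetric] by simp

lemma square_borel [measurable]: "square n \<in> sets borel"
  unfolding square_def borel_prod[symmetric] by simp

lemma measure_square: "measure lborel (square n) = real n"
proof -
  have "emeasure lborel (square n) = ennreal (real n)"
    unfolding square_def lborel_prod[symmetric]
    by (subst lborel.emeasure_pair_measure_Times) (auto simp flip: ennreal_mult)
  then show ?thesis by (simp add: measure_def)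
qed

context
  fixes P :: "'a measure" and n :: nat and N :: "'a \<Rightarrow> nat" and X :: "nat \<Rightarrow> 'a \<Rightarrow> point"
  assumes pp: "poisson_process P 1 (square n) N X"
begin

lemma prob_space_P: "prob_space P"
  using pp by (simp add: poisson_process_def)

lemma N_measurable: "N \<in> measurable P (count_space UNIV)"
  and X_measurable: "X i \<in> borel_measurable P"
  using pp by (simp_all add: poisson_process_def)

lemma AE_points: "AE \<omega> in P. inj_on (\<lambda>i. X i \<omega>) {..<N \<omega>} \<and> points N X \<omega> \<subseteq> square n"
  using pp by (simp add: poisson_process_def)

lemma indep_counts:
  assumes "B \<in> sets borel" "B \<subseteq> square n" "C \<in> sets borel" "C \<subseteq> square n" "B \<inter> C = {}"
  shows "prob_space.indep_vars P (\<lambda>_. count_space UNIV)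
     (\<lambda>i \<omega>. card (points N X \<omega> \<inter> (if i = 0 then B else C))) {0, 1::nat}"
proof -
  have "disjoint_family_on (\<lambda>i. if i = 0 then B else C) {0, 1::nat}"
    using assms by (auto simp: disjoint_family_on_def)
  then show ?thesis
    using pp assms unfolding poisson_process_def by (elim conjE allE[of _ "{0,1}"]) auto
qed

lemma count_measurable:
  assumes "B \<in> sets borel" "B \<subseteq> square n"
  shows "(\<lambda>\<omega>. card (points N X \<omega> \<inter> B)) \<in> measurable P (count_space UNIV)"
proof -
  interpret prob_space P by (rule prob_space_P)
  show ?thesis using indep_counts[OF assms, of "{}"] by (auto simp: indep_vars_def)
qed

lemma distr_count:
  assumes "B \<in> sets borel" "B \<subseteq> square n"
  shows "distr P (count_space UNIV) (\<lambda>\<omega>. card (points N X \<omega> \<inter> B)) = measure_pmf (poisson_law (measure lborel B))"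
  using pp assms by (simp add: poisson_process_def)

lemma nn_integral_count:
  assumes "B \<in> sets borel" "B \<subseteq> square n"
  shows "(\<integral>\<^sup>+\<omega>. ennreal (real (card (points N X \<omega> \<inter> B))) \<partial>P) = ennreal (measure lborel B)"
proof -
  have "(\<integral>\<^sup>+\<omega>. ennreal (real (card (points N X \<omega> \<inter> B))) \<partial>P)
      = (\<integral>\<^sup>+k. ennreal (real k) \<partial>distr P (count_space UNIV) (\<lambda>\<omega>. card (points N X \<omega> \<inter> B)))"
    by (subst nn_integral_distr[OF count_measurable[OF assms]]) auto
  then show ?thesis by (simp add: distr_count[OF assms] nn_integral_poisson_law_mean)
qed

lemma nn_integral_count_product:
  assumes "B \<in> sets borel" "B \<subseteq> square n" "C \<in> sets borel" "C \<subseteq> square n" "B \<inter> C = {}"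
  shows "(\<integral>\<^sup>+\<omega>. ennreal (real (card (points N X \<omega> \<inter> B) * card (points N X \<omega> \<inter> C))) \<partial>P)
     = ennreal (measure lborel B * measure lborel C)"
proof -
  interpret prob_space P by (rule prob_space_P)
  let ?Y = "\<lambda>(i::nat) \<omega>. ennreal (real (card (points N X \<omega> \<inter> (if i = 0 then B else C))))"
  have "indep_vars (\<lambda>_. borel) ?Y {0, 1}"
    using indep_vars_compose2[OF indep_counts[OF assms], of "\<lambda>_ k. ennreal (real k)" "\<lambda>_. borel"] by simp
  then have "(\<integral>\<^sup>+\<omega>. (\<Prod>i\<in>{0,1}. ?Y i \<omega>) \<partial>P) = (\<Prod>i\<in>{0,1}. \<integral>\<^sup>+\<omega>. ?Y i \<omega> \<partial>P)"
    by (intro indep_vars_nn_integral) auto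
  then show ?thesis by (simp add: nn_integral_count assms flip: ennreal_mult)
qed

text \<open>
  A union of \<open>N\<close> singletons has \<open>N\<close> elements almost surely only, so the measurability of its
  cardinality is proved by adding the points one by one.
\<close>

lemma card_points_measurable: "(\<lambda>\<omega>. card (points N X \<omega>)) \<in> measurable P (count_space UNIV)"
proof -
  have "(\<lambda>\<omega>. card ((\<lambda>i. X i \<omega>) ` {..<m})) \<in> measurable P (count_space UNIV)" for m
  proof (induction m)
    case (Suc m)
    note [measurable] = Suc X_measurable
    have "card ((\<lambda>i. X i \<omega>) ` {..<Suc m})
        = (if \<exists>i\<in>{..<m}. X i \<omega> = X m \<omega> then card ((\<lambda>i. X i \<omega>) ` {..<m}) else Suc (card ((\<lambda>i. X i \<omega>) ` {..<m})))" for \<omega>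
      by (auto simp: lessThan_Suc card_insert_if) (metis image_eqI lessThan_iff)
    then show ?case by simp
  qed simp
  then show ?thesis
    unfolding points_def by (rule measurable_compose_countable[OF _ N_measurable])
qed

lemma expectation_card_points: "(LINT \<omega>|P. real (card (points N X \<omega>))) = n"
proof -
  have "(\<lambda>\<omega>. real (card (points N X \<omega> \<inter> square n))) \<in> borel_measurable P"
    using count_measurable[OF square_borel order_refl] by measurable
  then have "(LINT \<omega>|P. real (card (points N X \<omega> \<inter> square n))) = n"
    by (subst integral_eq_nn_integral) (simp_all add: nn_integral_count measure_square)
  moreover have "(LINT \<omega>|P. real (card (points N X \<omega> \<inter> square n))) = (LINT \<omega>|P. real (card (points N X \<omega>)))"
  proof (rule integral_cong_AE)
    show "AE \<omega> in P. real (card (points N X \<omega> \<inter> square n)) = real (card (points N X \<omega>))"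
      using AE_points by eventually_elim (simp add: Int_absorb2)
    have "(\<lambda>\<omega>. card (points N X \<omega>)) \<in> measurable P (count_space UNIV)"
      by (rule card_points_measurable)
    then show "(\<lambda>\<omega>. real (card (points N X \<omega>))) \<in> borel_measurable P" by measurable
  qed fact
  ultimately show ?thesis by simp
qed

lemma prob_few_points:
  "measure P {\<omega>\<in>space P. real (card (points N X \<omega> \<inter> square n)) \<le> n / 4} \<le> exp (- real n / 4)"
proof -
  have "measure P {\<omega>\<in>space P. real (card (points N X \<omega> \<inter> square n)) \<le> n / 4}
     = measure (distr P (count_space UNIV) (\<lambda>\<omega>. card (points N X \<omega> \<inter> square n))) {k. real k \<le> n / 4}"
    by (subst measure_distr[OF count_measurable]) (auto intro!: arg_cong[where f="measure _"])
  also have "\<dots> \<le> exp (- real n / 4)"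
    by (subst distr_count) (use poisson_law_lower_tail[of "real n"] in \<open>simp_all add: measure_square\<close>)
  finally show ?thesis .
qed

lemma sparse_cells_measurable:
  "{\<omega>\<in>space P. sparse_cells n R (points N X \<omega>)} \<in> sets P"
proof -
  have [measurable]: "(\<lambda>\<omega>. card (points N X \<omega> \<inter> (cell b i j \<inter> square n))) \<in> measurable P (count_space UNIV)" for b i j
    by (intro count_measurable) auto
  show ?thesis unfolding sparse_cells_def by measurable
qed

lemma prob_not_sparse_cells:
  assumes R: "0 < R"
  shows "measure P {\<omega>\<in>space P. \<not> sparse_cells n R (points N X \<omega>)} \<le> real n * (real n + 1)\<^sup>2 * exp (- R\<^sup>2)"
proof -
  interpret prob_space P by (rule prob_space_P)
  let ?c = "\<lambda>k i j. cell (real k * R) (int i) (int j) \<inter> square n"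
  define D where "D k i j = {\<omega>\<in>space P. 4 * (real k * R)\<^sup>2 < real (card (points N X \<omega> \<inter> ?c k i j))}" for k i j
  have meas: "(\<lambda>\<omega>. card (points N X \<omega> \<inter> ?c k i j)) \<in> measurable P (count_space UNIV)" for k i j
    by (intro count_measurable) auto
  have D: "D k i j \<in> events" for k i j
    unfolding D_def using meas[of k i j] by measurable
  have prob_D: "prob (D k i j) \<le> exp (- R\<^sup>2)" if "1 \<le> k" for k i j
  proof -
    have "measure lborel (?c k i j) \<le> measure lborel (cell (real k * R) (int i) (int j))"
      using R by (intro measure_mono_fmeasurable) (auto simp: fmeasurable_def emeasure_cell)
    also have "\<dots> = (real k * R)\<^sup>2" using R by (simp add: measure_def emeasure_cell)
    finally have le: "measure lborel (?c k i j) \<le> (real k * R)\<^sup>2" .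
    have "prob (D k i j) = measure (distr P (count_space UNIV) (\<lambda>\<omega>. card (points N X \<omega> \<inter> ?c k i j))) {m. 4 * (real k * R)\<^sup>2 < real m}"
      unfolding D_def by (subst measure_distr[OF meas]) (auto intro!: arg_cong[where f="measure _"])
    also have "\<dots> \<le> exp (- ((real k * R)\<^sup>2))"
      using le by (subst distr_count) (auto intro!: poisson_law_upper_tail)
    also have "1 * R \<le> real k * R" using that R by (intro mult_right_mono) auto
    then have "R\<^sup>2 \<le> (real k * R)\<^sup>2" using R by (intro power_mono) auto
    then have "exp (- ((real k * R)\<^sup>2)) \<le> exp (- R\<^sup>2)" by simp
    finally show ?thesis .
  qed
  have "{\<omega>\<in>space P. \<not> sparse_cells n R (points N X \<omega>)} = (\<Union>(k, i, j)\<in>{1..n} \<times> {..n} \<times> {..n}. D k i j)"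
    by (auto simp: sparse_cells_def D_def not_le)
  then have "prob {\<omega>\<in>space P. \<not> sparse_cells n R (points N X \<omega>)}
     \<le> (\<Sum>(k, i, j)\<in>{1..n} \<times> {..n} \<times> {..n}. prob (D k i j))"
    using D by (auto intro!: finite_measure_subadditive_finite simp: case_prod_unfold)
  also have "\<dots> \<le> real (card ({1..n} \<times> {..n} \<times> {..n})) * exp (- R\<^sup>2)"
    using prob_D by (intro sum_bounded_above) auto
  finally show ?thesis by (simp add: power2_eq_square algebra_simps)
qed

end

section \<open>The edge probabilities\<close>

lemma torus_dist_second_next_cell:
  assumes l: "0 < l" "real M * l = sqrt n" and i: "i + 3 \<le> M" "4 \<le> M"
    and x: "x \<in> cell l (int i) (int j)" and y: "y \<in> cell l (int i + 2) (int j)"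
  shows "l < torus_dist n x y" "torus_dist n x y \<le> 4 * l"
proof -
  have x': "real i * l \<le> fst x" "fst x < real i * l + l" "real j * l \<le> snd x" "snd x < real j * l + l"
    using x by (auto simp: cell_def mem_Times_iff algebra_simps)
  have y': "real i * l + 2 * l \<le> fst y" "fst y < real i * l + 3 * l" "real j * l \<le> snd y" "snd y < real j * l + l"
    using y by (auto simp: cell_def mem_Times_iff algebra_simps)
  have "4 * l \<le> real M * l" using l i by (intro mult_right_mono) auto
  then have sq: "4 * l \<le> sqrt n" using l by simp
  have c1: "l < circle_dist (sqrt n) (fst x) (fst y)" "circle_dist (sqrt n) (fst x) (fst y) \<le> 3 * l"
    using x' y' sq by (auto simp: circle_dist_def)
  have c2: "0 \<le> circle_dist (sqrt n) (snd x) (snd y)" "circle_dist (sqrt n) (snd x) (snd y) \<le> l"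
    using x' y' sq l by (auto simp: circle_dist_def)
  show "l < torus_dist n x y" using c1 circle_dist_le_torus_dist(1)[of n x y] by linarith
  have "torus_dist n x y \<le> circle_dist (sqrt n) (fst x) (fst y) + circle_dist (sqrt n) (snd x) (snd y)"
    unfolding torus_dist_def using c1 c2 l by (intro sqrt_sum_squares_le_sum) auto
  then show "torus_dist n x y \<le> 4 * l" using c1 c2 by linarith
qed

text \<open>
  Two points in the cells \<open>(i, j)\<close> and \<open>(i + 2, j)\<close> of side \<open>l\<close> have a distance between \<open>l\<close> and
  \<open>4 l\<close>. By the hypothesis on \<open>a\<close>, the edge probability is \<open>1\<close> at this distance, and the points are too far apart for a local
  edge, so all such pairs are joined by shortcuts. The pairs for different cells are different, as
  cells are disjoint.
\<close>

lemma card_shortcuts_ge_cell_pairs: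
  assumes inj: "inj_on (\<lambda>i. X i \<omega>) {..<N \<omega>}"
    and l: "0 < l" "real M * l = sqrt n" "local_radius c n \<le> l" "4 \<le> M"
    and a: "1 \<le> a * (4 * l) powr (- \<alpha>)" "0 \<le> \<alpha>"
    and u: "\<And>i j. i \<noteq> j \<Longrightarrow> u {i, j} < 1"
  shows "(\<Sum>(i, j)\<in>{..<M - 2} \<times> {..<M}. card (points N X \<omega> \<inter> cell l (int i) (int j)) * card (points N X \<omega> \<inter> cell l (int i + 2) (int j)))
    \<le> (\<Sum>x\<in>points N X \<omega>. card (shortcut_contacts (shortcuts c \<alpha> a n N X (\<omega>, u)) x))"
proof -
  define V where "V = points N X \<omega>"
  define E where "E = shortcuts c \<alpha> a n N X (\<omega>, u)"
  have finV: "finite V" by (simp add: V_def finite_points)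
  have EV: "E \<subseteq> V \<times> V" using shortcuts_subset[of c \<alpha> a n N X \<omega> u] by (simp add: E_def V_def)
  then have finE: "finite E" using finV by (auto intro: finite_subset)
  let ?pairs = "\<lambda>(i, j). (V \<inter> cell l (int i) (int j)) \<times> (V \<inter> cell l (int i + 2) (int j))"
  have "disjoint_family_on ?pairs ({..<M - 2} \<times> {..<M})"
    using l by (auto simp: disjoint_family_on_def mem_cell_iff)
  then have card_eq: "card (\<Union>(?pairs ` ({..<M - 2} \<times> {..<M}))) = (\<Sum>q\<in>{..<M - 2} \<times> {..<M}. card (?pairs q))"
    using finV by (intro card_UN_disjoint) (auto simp: disjoint_family_on_def)
  have sub: "\<Union>(?pairs ` ({..<M - 2} \<times> {..<M})) \<subseteq> E"
  proof safe
    fix i j x x' y y' assume ij: "i < M - 2" "j < M"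
      and xy: "(x, x') \<in> V" "(x, x') \<in> cell l (int i) (int j)" "(y, y') \<in> V" "(y, y') \<in> cell l (int i + 2) (int j)"
    let ?x = "(x, x')" and ?y = "(y, y')"
    have d: "l < torus_dist n ?x ?y" "torus_dist n ?x ?y \<le> 4 * l"
      using torus_dist_second_next_cell[OF l(1,2) _ l(4) xy(2,4)] ij by auto
    have "?x \<noteq> ?y" using xy(2,4) l(1) by (auto simp: mem_cell_iff)
    obtain p where p: "p < N \<omega>" "?x = X p \<omega>"
      using xy(1) unfolding V_def points_def by (elim imageE) auto
    obtain q where q: "q < N \<omega>" "?y = X q \<omega>"
      using xy(3) unfolding V_def points_def by (elim imageE) auto
    have "p \<noteq> q" using \<open>?x \<noteq> ?y\<close> p q by auto
    note pq = p(1) q(1) p(2) q(2) this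
    have apos: "0 < a"
    proof (rule ccontr)
      assume "\<not> 0 < a"
      then have "a * (4 * l) powr (- \<alpha>) \<le> 0" by (intro mult_nonpos_nonneg) auto
      with a show False by linarith
    qed
    have "1 \<le> a * (4 * l) powr (- \<alpha>)" by fact
    also have "\<dots> \<le> a * torus_dist n ?x ?y powr (- \<alpha>)"
      using apos d l a by (intro mult_left_mono powr_mono2') auto
    finally have "u {p, q} < min (a * torus_dist n (X p \<omega>) (X q \<omega>) powr (- \<alpha>)) 1"
      using u[OF pq(5)] pq by simp
    then show "(?x, ?y) \<in> E"
      unfolding E_def pq(3,4) mem_shortcuts_iff[where X=X and N=N and \<omega>=\<omega>, OF inj pq(1,2)]
      using d l pq by auto
  qed
  have "(\<Sum>q\<in>{..<M - 2} \<times> {..<M}. card (?pairs q)) \<le> card E"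
    using card_mono[OF finE sub] unfolding card_eq .
  moreover have "card E = (\<Sum>x\<in>V. card (shortcut_contacts E x))"
  proof -
    have "shortcut_contacts E x \<subseteq> V" for x using EV unfolding shortcut_contacts_def by blast
    then have "finite (shortcut_contacts E x)" for x using finV by (rule finite_subset)
    then have "card (Sigma V (shortcut_contacts E)) = (\<Sum>x\<in>V. card (shortcut_contacts E x))"
      using finV by (intro card_SigmaI) auto
    moreover have "E = Sigma V (shortcut_contacts E)"
      using EV unfolding shortcut_contacts_def by blast
    ultimately show ?thesis by simp
  qed
  ultimately show ?thesis by (simp add: E_def V_def case_prod_unfold card_cartesian_product)
qed

text \<open>
  If the inequality failed, all pairs of nodes in cells \<open>(i, j)\<close> and \<open>(i + 2, j)\<close> would be joined.
  There are \<open>(M - 2) M\<close> pairs of cells, each with \<open>l\<^sup>2 * l\<^sup>2\<close> pairs of nodes on average, in total at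
  least \<open>n l\<^sup>2 / 2\<close> because \<open>M l = \<surd>n\<close>. This is more than the \<open>n dbar\<close> shortcuts that there are on
  average.
\<close>

lemma mean_shortcuts_constant_less:
  assumes pp: "poisson_process P 1 (square n) N X"
    and mean: "mean_shortcuts c \<alpha> a n P N X = dbar" "0 < dbar" and \<alpha>: "0 \<le> \<alpha>"
    and l: "0 < l" "real M * l = sqrt n" "local_radius c n \<le> l" "4 \<le> M" and big: "2 * dbar < l\<^sup>2"
  shows "a < (4 * l) powr \<alpha>"
proof (rule ccontr)
  assume "\<not> ?thesis"
  then have a: "1 \<le> a * (4 * l) powr (- \<alpha>)"
    using l by (simp add: powr_minus field_simps)
  interpret P: prob_space P using pp by (rule prob_space_P)
  interpret E: prob_space edge_marks by (rule prob_space_edge_marks)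
  have "0 < real M * l" using l(1,4) by simp
  then have n: "0 < real n" "real n = (real M * l)\<^sup>2" unfolding l(2) by simp_all
  define F where "F g = (\<Sum>x\<in>points N X (fst g). real (card (shortcut_contacts (shortcuts c \<alpha> a n N X g) x)))" for g
  define G where "G \<omega> = (\<Sum>(i, j)\<in>{..<M - 2} \<times> {..<M}.
     real (card (points N X \<omega> \<inter> cell l (int i) (int j)) * card (points N X \<omega> \<inter> cell l (int i + 2) (int j))))" for \<omega>
  have int: "(LINT g|graph_space P. F g) = dbar * n"
    using mean(1) n(1) by (simp add: mean_shortcuts_def expectation_card_points[OF pp] F_def divide_eq_eq)
  \<comment> \<open>A function that is not integrable would have integral \<open>0\<close>.\<close>
  then have F: "integrable (graph_space P) F"
    using not_integrable_integral_eq[of "graph_space P" F] mean(2) n(1) by auto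
  have sub: "cell l (int i) (int j) \<subseteq> square n" if "i < M" "j < M" for i j
  proof -
    have "{real k * l ..< (real k + 1) * l} \<subseteq> {0..sqrt n}" if "k < M" for k
    proof -
      have "(real k + 1) * l \<le> sqrt n"
        unfolding l(2)[symmetric] using that l(1) by (intro mult_right_mono) auto
      moreover have "0 \<le> real k * l" using l(1) by simp
      ultimately show ?thesis by fastforce
    qed
    then show ?thesis using that unfolding cell_def square_def by (intro Sigma_mono) auto
  qed
  have sub2: "cell l (int i) (int j) \<subseteq> square n" "cell l (int i + 2) (int j) \<subseteq> square n"
    if "i < M - 2" "j < M" for i j
  proof -
    have "i < M" "i + 2 < M" using that by linarith+
    then show "cell l (int i) (int j) \<subseteq> square n" "cell l (int i + 2) (int j) \<subseteq> square n"
      using sub[of i j] sub[of "i + 2" j] that by (simp_all add: add.commute)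
  qed
  have "ennreal (dbar * n) = (\<integral>\<^sup>+g. F g \<partial>graph_space P)"
    using nn_integral_eq_integral[OF F] int by (simp add: F_def sum_nonneg)
  also have "\<dots> = (\<integral>\<^sup>+\<omega>. \<integral>\<^sup>+u. F (\<omega>, u) \<partial>edge_marks \<partial>P)"
    using F unfolding graph_space_def by (subst E.nn_integral_fst[symmetric]) auto
  also have "\<dots> \<ge> (\<integral>\<^sup>+\<omega>. \<integral>\<^sup>+u. G \<omega> \<partial>edge_marks \<partial>P)"
  proof (rule nn_integral_mono_AE)
    have AE_u: "AE u in edge_marks. \<forall>i j. i \<noteq> j \<longrightarrow> u {i, j} < 1"
      unfolding AE_all_countable using AE_mark_less_1 by (auto simp: card_insert_if AE_all_countable)
    show "AE \<omega> in P. (\<integral>\<^sup>+u. G \<omega> \<partial>edge_marks) \<le> (\<integral>\<^sup>+u. F (\<omega>, u) \<partial>edge_marks)"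
      using AE_points[OF pp]
    proof eventually_elim
      case (elim \<omega>)
      show ?case
      proof (rule nn_integral_mono_AE)
        show "AE u in edge_marks. ennreal (G \<omega>) \<le> ennreal (F (\<omega>, u))"
          using AE_u
        proof eventually_elim
          case (elim u)
          then have "(\<Sum>(i, j)\<in>{..<M - 2} \<times> {..<M}. card (points N X \<omega> \<inter> cell l (int i) (int j)) * card (points N X \<omega> \<inter> cell l (int i + 2) (int j)))
             \<le> (\<Sum>x\<in>points N X \<omega>. card (shortcut_contacts (shortcuts c \<alpha> a n N X (\<omega>, u)) x))"
            using \<open>inj_on (\<lambda>i. X i \<omega>) {..<N \<omega>} \<and> _\<close>
            by (intro card_shortcuts_ge_cell_pairs[OF _ l a \<alpha>]) auto
          then show ?case
            unfolding F_def G_def by (intro ennreal_leI) (simp add: case_prod_unfold flip: of_nat_sum of_nat_mult)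
        qed
      qed
    qed
  qed
  also have "(\<integral>\<^sup>+\<omega>. \<integral>\<^sup>+u. G \<omega> \<partial>edge_marks \<partial>P) = (\<integral>\<^sup>+\<omega>. G \<omega> \<partial>P)"
    by (simp add: E.emeasure_space_1)
  also have "\<dots> = (\<integral>\<^sup>+\<omega>. (\<Sum>(i, j)\<in>{..<M - 2} \<times> {..<M}.
     ennreal (real (card (points N X \<omega> \<inter> cell l (int i) (int j)) * card (points N X \<omega> \<inter> cell l (int i + 2) (int j))))) \<partial>P)"
    unfolding G_def by (intro nn_integral_cong) (simp add: case_prod_unfold)
  also have "\<dots> = (\<Sum>(i, j)\<in>{..<M - 2} \<times> {..<M}. \<integral>\<^sup>+\<omega>.
     ennreal (real (card (points N X \<omega> \<inter> cell l (int i) (int j)) * card (points N X \<omega> \<inter> cell l (int i + 2) (int j)))) \<partial>P)"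
    unfolding case_prod_unfold
  proof (subst nn_integral_sum)
    fix q assume q: "q \<in> {..<M - 2} \<times> {..<M}"
    have rv: "(\<lambda>\<omega>. real (card (points N X \<omega> \<inter> B))) \<in> borel_measurable P"
      if "B \<in> sets borel" "B \<subseteq> square n" for B
      by (rule measurable_compose[OF count_measurable[OF pp that]]) simp
    have "fst q < M - 2" "snd q < M" using q by auto
    note s = sub2[OF this]
    note borel_measurable_times[OF rv[OF cell_borel s(1)] rv[OF cell_borel s(2)]]
    from measurable_compose[OF this measurable_ennreal]
    show "(\<lambda>\<omega>. ennreal (real (card (points N X \<omega> \<inter> cell l (int (fst q)) (int (snd q))) *
       card (points N X \<omega> \<inter> cell l (int (fst q) + 2) (int (snd q)))))) \<in> borel_measurable P"
      by (simp only: of_nat_mult)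
  qed simp
  also have "\<dots> = (\<Sum>(i, j)\<in>{..<M - 2} \<times> {..<M}. ennreal (l\<^sup>2 * l\<^sup>2))"
  proof (intro sum.cong refl, clarify)
    fix i j assume "i < M - 2" "j < M"
    note s = sub2[OF this]
    have "cell l (int i) (int j) \<inter> cell l (int i + 2) (int j) = {}"
      using l(1) by (auto simp: mem_cell_iff)
    moreover have "measure lborel (cell l p q) = l\<^sup>2" for p q using l by (simp add: measure_def emeasure_cell)
    ultimately show "(\<integral>\<^sup>+\<omega>. ennreal (real (card (points N X \<omega> \<inter> cell l (int i) (int j)) *
       card (points N X \<omega> \<inter> cell l (int i + 2) (int j)))) \<partial>P) = ennreal (l\<^sup>2 * l\<^sup>2)"
      using nn_integral_count_product[OF pp cell_borel s(1) cell_borel s(2)] by simp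
  qed
  also have "\<dots> = ennreal (real (M - 2) * real M * (l\<^sup>2 * l\<^sup>2))"
    by (simp add: case_prod_unfold ennreal_mult' flip: ennreal_of_nat_eq_real_of_nat)
  finally have "real (M - 2) * real M * (l\<^sup>2 * l\<^sup>2) \<le> dbar * n"
    using mean by (subst (asm) ennreal_le_iff) auto
  moreover have "(real M / 2) * real M * (l\<^sup>2 * l\<^sup>2) \<le> real (M - 2) * real M * (l\<^sup>2 * l\<^sup>2)"
    using l by (intro mult_right_mono) (auto simp: of_nat_diff)
  moreover have "(real M / 2) * real M * (l\<^sup>2 * l\<^sup>2) = n * (l\<^sup>2 / 2)"
    unfolding n(2) by (simp add: power2_eq_square)
  ultimately have "n * (l\<^sup>2 / 2) \<le> n * dbar" by (simp add: mult.commute)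
  then have "l\<^sup>2 / 2 \<le> dbar" using n(1) by (simp only: mult_le_cancel_left_pos)
  then show False using big by simp
qed

text \<open>
  Cells of side about \<open>n\<^sup>\<delta>\<close> satisfy the hypotheses of the previous bound for
  large \<open>n\<close>. The number of cells in a row has to be an integer, so the side is only
  determined up to a factor \<open>2\<close>, which turns \<open>4\<close> into \<open>8\<close>.
\<close>

lemma eventually_edge_constant_le:
  assumes pp: "\<And>n. poisson_process (P n) 1 (square n) (N n) (X n)"
    and mean: "\<forall>\<^sub>F n in sequentially. mean_shortcuts c \<alpha> (a n) n (P n) (N n) (X n) = dbar"
    and dbar: "0 < dbar" and \<alpha>: "0 \<le> \<alpha>" and c: "0 < c" and \<delta>: "0 < \<delta>" "\<delta> < 1 / 2"
  shows "\<forall>\<^sub>F n in sequentially. a n \<le> 8 powr \<alpha> * real n powr (\<delta> * \<alpha>)"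
proof -
  have 1: "\<forall>\<^sub>F n in sequentially. 4 \<le> sqrt (real n) / real n powr \<delta>"
    using \<delta> by real_asymp
  have 2: "\<forall>\<^sub>F n in sequentially. local_radius c n \<le> real n powr \<delta>"
    unfolding local_radius_def using c \<delta> by real_asymp
  have 3: "\<forall>\<^sub>F n in sequentially. 2 * dbar < (real n powr \<delta>)\<^sup>2"
    using \<delta> by real_asymp
  show ?thesis
    using 1 2 3 mean eventually_gt_at_top[of 0]
  proof eventually_elim
    case (elim n)
    define M where "M = nat \<lfloor>sqrt (real n) / real n powr \<delta>\<rfloor>"
    define l where "l = sqrt n / M"
    have n\<delta>: "0 < real n powr \<delta>" using elim by simp
    have M: "4 \<le> M" "real M \<le> sqrt n / real n powr \<delta>" "sqrt n / real n powr \<delta> \<le> 2 * real M"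
      using elim(1) unfolding M_def by linarith+
    have l: "real n powr \<delta> \<le> l" "l \<le> 2 * real n powr \<delta>"
      using M n\<delta> by (auto simp: l_def field_simps)
    have "(real n powr \<delta>)\<^sup>2 \<le> l\<^sup>2" using l n\<delta> by (intro power_mono) auto
    then have "2 * dbar < l\<^sup>2" using elim(3) by linarith
    then have "a n < (4 * l) powr \<alpha>"
      using elim(2,5) M l n\<delta> by (intro mean_shortcuts_constant_less[OF pp elim(4) dbar \<alpha>, of l M]) (auto simp: l_def)
    also have "\<dots> \<le> (8 * real n powr \<delta>) powr \<alpha>"
      using l n\<delta> \<alpha> by (intro powr_mono2) auto
    finally show ?case by (simp add: powr_mult powr_powr)
  qed
qed

section \<open>Source, destination and a single torus\<close>

lemma prob_space_uniform01: "prob_space (uniform_measure lborel {0..<1::real})"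
  by (rule prob_space_uniform_measure) simp_all

lemma AE_uniform01: "AE v in uniform_measure lborel {0..<1::real}. v \<in> {0..<1}"
  by (rule AE_uniform_measureI) simp_all

lemma index_less:
  assumes "v \<in> {0..<1}" "0 < m"
  shows "nat \<lfloor>v * real m\<rfloor> < m"
proof -
  have "v * real m < 1 * real m" using assms by (intro mult_strict_right_mono) auto
  then have "\<lfloor>v * real m\<rfloor> < int m" by (simp add: floor_less_iff)
  then show ?thesis using assms(2) by linarith
qed

lemma emeasure_index_le:
  assumes "0 < m" "finite J"
  shows "emeasure (uniform_measure lborel {0..<1}) {v. nat \<lfloor>v * real m\<rfloor> \<in> J} \<le> ennreal (real (card J) / m)"
proof -
  have meas: "{v :: real. nat \<lfloor>v * real m\<rfloor> \<in> J} \<in> sets lborel" by measurable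
  have "{0..<1} \<inter> {v. nat \<lfloor>v * real m\<rfloor> \<in> J} \<subseteq> (\<Union>j\<in>J. {real j / m ..< (real j + 1) / m})"
  proof
    fix v assume v: "v \<in> {0..<1} \<inter> {v. nat \<lfloor>v * real m\<rfloor> \<in> J}"
    define j where "j = nat \<lfloor>v * real m\<rfloor>"
    have "0 \<le> v * real m" using v by simp
    then have "real j \<le> v * m" "v * m < real j + 1" unfolding j_def by linarith+
    then have "v \<in> {real j / m ..< (real j + 1) / m}" using assms by (simp add: field_simps)
    moreover have "j \<in> J" using v by (simp add: j_def)
    ultimately show "v \<in> (\<Union>j\<in>J. {real j / m ..< (real j + 1) / m})" by blast
  qed
  then have "emeasure lborel ({0..<1} \<inter> {v. nat \<lfloor>v * real m\<rfloor> \<in> J})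
      \<le> emeasure lborel (\<Union>j\<in>J. {real j / m ..< (real j + 1) / m})"
    using assms by (intro emeasure_mono sets.finite_UN) auto
  also have "\<dots> \<le> (\<Sum>j\<in>J. emeasure lborel {real j / m ..< (real j + 1) / m})"
    using assms by (intro emeasure_subadditive_finite) auto
  also have "\<dots> = (\<Sum>j\<in>J. ennreal (1 / m))"
    by (intro sum.cong refl, subst emeasure_lborel_Ico) (auto simp: divide_right_mono simp flip: diff_divide_distrib)
  also have "\<dots> = ennreal (real (card J) / m)"
    by (simp add: ennreal_of_nat_eq_real_of_nat flip: ennreal_mult)
  finally show ?thesis using meas by (subst emeasure_uniform_measure) (simp_all add: divide_ennreal_def)
qed

lemma pick_in_points:
  assumes "v \<in> {0..<1}" "0 < N \<omega>"
  shows "pick N X \<omega> v \<in> points N X \<omega>"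
  using index_less[OF assms] by (auto simp: pick_def points_def)

text \<open>
  Whatever the source, at most \<open>1296 D\<^sup>2\<close> of the at least \<open>n / 4\<close> nodes are within \<open>D\<close> of it.
\<close>

lemma nn_integral_close_le:
  assumes inj: "inj_on (\<lambda>i. X i \<omega>) {..<N \<omega>}" and V: "points N X \<omega> \<subseteq> square n"
    and sparse: "sparse_cells n R (points N X \<omega>)" and R: "1 \<le> R" "R \<le> D"
    and n: "1 \<le> n" "real n / 4 < real (N \<omega>)"
  shows "(\<integral>\<^sup>+v. \<integral>\<^sup>+v'. indicator {q. torus_dist n (pick N X \<omega> (fst q)) (pick N X \<omega> (snd q)) \<le> D} (v, v')
       \<partial>uniform_measure lborel {0..<1} \<partial>uniform_measure lborel {0..<1}) \<le> ennreal (5184 * D\<^sup>2 / n)"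
proof -
  let ?U = "uniform_measure lborel {0..<1::real}"
  let ?d = "\<lambda>v v'. torus_dist n (pick N X \<omega> v) (pick N X \<omega> v')"
  interpret U: prob_space ?U by (rule prob_space_uniform01)
  have N: "0 < N \<omega>" using n by linarith
  have "(\<integral>\<^sup>+v'. indicator {q. ?d (fst q) (snd q) \<le> D} (v, v') \<partial>?U) \<le> ennreal (5184 * D\<^sup>2 / n)"
    if v: "v \<in> {0..<1}" for v
  proof -
    define J where "J = {j. j < N \<omega> \<and> torus_dist n (pick N X \<omega> v) (X j \<omega>) \<le> D}"
    have J: "finite J" by (simp add: J_def)
    have "card J = card ((\<lambda>j. X j \<omega>) ` J)"
      by (rule card_image[symmetric]) (auto simp: J_def intro: inj_on_subset[OF inj])
    also have "(\<lambda>j. X j \<omega>) ` J = {y\<in>points N X \<omega>. torus_dist n (pick N X \<omega> v) y \<le> D}"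
      by (auto simp: J_def points_def)
    finally have "real (card J) \<le> 1296 * D\<^sup>2"
      using card_torus_ball_le[OF finite_points V sparse R subsetD[OF V pick_in_points[where N=N and \<omega>=\<omega>, OF v N]] n(1)] by simp
    then have "real (card J) / N \<omega> \<le> 1296 * D\<^sup>2 / (n / 4)"
      using n by (intro frac_le) auto
    then have le: "real (card J) / N \<omega> \<le> 5184 * D\<^sup>2 / n" by simp
    have "(\<integral>\<^sup>+v'. indicator {q. ?d (fst q) (snd q) \<le> D} (v, v') \<partial>?U)
        \<le> (\<integral>\<^sup>+v'. indicator {v'. nat \<lfloor>v' * real (N \<omega>)\<rfloor> \<in> J} v' \<partial>?U)"
    proof (rule nn_integral_mono_AE)
      show "AE v' in ?U. (indicator {q. ?d (fst q) (snd q) \<le> D} (v, v') :: ennreal)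
          \<le> indicator {v'. nat \<lfloor>v' * real (N \<omega>)\<rfloor> \<in> J} v'"
        using AE_uniform01
        by eventually_elim (use index_less[OF _ N] in \<open>auto simp: indicator_def J_def pick_def\<close>)
    qed
    also have "\<dots> = emeasure ?U {v'. nat \<lfloor>v' * real (N \<omega>)\<rfloor> \<in> J}"
      by (intro nn_integral_indicator) measurable
    also have "\<dots> \<le> ennreal (real (card J) / N \<omega>)" by (rule emeasure_index_le[OF N J])
    also have "\<dots> \<le> ennreal (5184 * D\<^sup>2 / n)" using le by (rule ennreal_leI)
    finally show ?thesis .
  qed
  then have "(\<integral>\<^sup>+v. \<integral>\<^sup>+v'. indicator {q. ?d (fst q) (snd q) \<le> D} (v, v') \<partial>?U \<partial>?U)
      \<le> (\<integral>\<^sup>+v. ennreal (5184 * D\<^sup>2 / n) \<partial>?U)"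
    by (intro nn_integral_mono_AE eventually_mono[OF AE_uniform01])
  then show ?thesis by (simp add: U.emeasure_space_1)
qed

lemma route_eq_visited:
  "route c \<alpha> a n N X A ((\<omega>, u), (v, v'), w) k =
     last (visited (knowledge c n (points N X \<omega>) (shortcuts c \<alpha> a n N X (\<omega>, u)))
       (A w (pick N X \<omega> v')) (pick N X \<omega> v) (pick N X \<omega> v') k)"
  by (simp add: route_def source_def destination_def)

lemma nn_integral_reached_le:
  assumes inj: "inj_on (\<lambda>i. X i \<omega>) {..<N \<omega>}" and V: "points N X \<omega> \<subseteq> square n"
    and sparse: "sparse_cells n R (points N X \<omega>)" and R: "1 \<le> R" "local_radius c n \<le> R"
    and n: "1 \<le> n" "0 < N \<omega>" and \<alpha>: "2 < \<alpha>" and a: "a \<le> a0" "0 \<le> a0"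
    and A: "decentralised_algorithm W A" "w \<in> W"
    and v: "v \<in> {0..<1}" "v' \<in> {0..<1}"
    and far: "real k * R < torus_dist n (pick N X \<omega> v) (pick N X \<omega> v')"
  shows "(\<integral>\<^sup>+u. indicator {z. route c \<alpha> a n N X A z k = destination N X z} ((\<omega>, u), (v, v'), w) \<partial>edge_marks)
     \<le> ennreal (real (Suc k) * (a0 * (5184 / (1 - 2 powr (2 - \<alpha>)) * R powr (2 - \<alpha>))))"
proof -
  interpret prob_space edge_marks by (rule prob_space_edge_marks)
  define s where "s = pick N X \<omega> v"
  define t where "t = pick N X \<omega> v'"
  have st: "s \<in> points N X \<omega>" "t \<in> points N X \<omega>"
    unfolding s_def t_def using v n by (auto intro: pick_in_points)
  have f: "A w t h \<in> known_contacts h" if "known_contacts h \<noteq> {}" for h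
    using A that unfolding decentralised_algorithm_def by blast
  have tail: "(\<Sum>y | y \<in> points N X \<omega> \<and> R < torus_dist n x y. max 0 (a * torus_dist n x y powr (- \<alpha>)))
      \<le> a0 * (5184 / (1 - 2 powr (2 - \<alpha>)) * R powr (2 - \<alpha>))" if x: "x \<in> points N X \<omega>" for x
  proof -
    have "(\<Sum>y | y \<in> points N X \<omega> \<and> R < torus_dist n x y. max 0 (a * torus_dist n x y powr (- \<alpha>)))
        \<le> (\<Sum>y | y \<in> points N X \<omega> \<and> R < torus_dist n x y. a0 * torus_dist n x y powr (- \<alpha>))"
      using a by (intro sum_mono) (auto intro!: mult_right_mono)
    also have "\<dots> = a0 * (\<Sum>y | y \<in> points N X \<omega> \<and> R < torus_dist n x y. torus_dist n x y powr (- \<alpha>))"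
      by (simp add: sum_distrib_left)
    also have "\<dots> \<le> a0 * (4 * 1296 / (1 - 2 powr (2 - \<alpha>)) * R powr (2 - \<alpha>))"
      using a R x V \<alpha> card_torus_ball_le[OF finite_points V sparse R(1) _ _ n(1), of _ x]
      by (intro mult_left_mono sum_powr_outside_ball_le finite_points V) auto
    finally show ?thesis by simp
  qed
  obtain B where B: "B \<in> sets edge_marks"
    "{u\<in>space edge_marks. last (visited (knowledge c n (points N X \<omega>) (shortcuts c \<alpha> a n N X (\<omega>, u))) (A w t) s t k) = t} \<subseteq> B"
    "measure edge_marks B \<le> real (Suc k) * (a0 * (5184 / (1 - 2 powr (2 - \<alpha>)) * R powr (2 - \<alpha>)))"
    using prob_reached_le[where f="A w t" and k=k, OF inj V st _ R(2) f _ tail] R far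
    unfolding s_def t_def by auto
  have "(\<integral>\<^sup>+u. indicator {z. route c \<alpha> a n N X A z k = destination N X z} ((\<omega>, u), (v, v'), w) \<partial>edge_marks)
      \<le> (\<integral>\<^sup>+u. indicator B u \<partial>edge_marks)"
    using B(2) by (intro nn_integral_mono) (auto simp: indicator_def route_eq_visited destination_def s_def t_def)
  also have "\<dots> = ennreal (measure edge_marks B)" using B(1) by (simp add: emeasure_eq_measure)
  also have "\<dots> \<le> ennreal (real (Suc k) * (a0 * (5184 / (1 - 2 powr (2 - \<alpha>)) * R powr (2 - \<alpha>))))"
    using B(3) by (rule ennreal_leI)
  finally show ?thesis .
qed

lemma measurable_pick:
  assumes N: "N \<in> measurable M (count_space UNIV)" and X: "\<And>i. X i \<in> borel_measurable M"
    and f: "f \<in> measurable L M" and g: "g \<in> borel_measurable L"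
  shows "(\<lambda>z. pick N X (f z) (g z)) \<in> borel_measurable L"
  unfolding pick_def
proof (rule measurable_compose_countable)
  show "(\<lambda>z. X i (f z)) \<in> borel_measurable L" for i
    by (rule measurable_compose[OF f X])
  have "(\<lambda>z. real (N (f z))) \<in> borel_measurable L"
    by (rule measurable_compose[OF measurable_compose[OF f N]]) simp
  with g show "(\<lambda>z. nat \<lfloor>g z * real (N (f z))\<rfloor>) \<in> measurable L (count_space UNIV)" by measurable
qed

lemma measurable_torus_dist:
  assumes "f \<in> borel_measurable M" "g \<in> borel_measurable M"
  shows "(\<lambda>x. torus_dist n (f x) (g x)) \<in> borel_measurable M"
proof -
  have "(\<lambda>x. fst (h x)) \<in> borel_measurable M" "(\<lambda>x. snd (h x)) \<in> borel_measurable M"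
    if "h \<in> borel_measurable M" for h :: "_ \<Rightarrow> point"
    using that unfolding borel_prod[symmetric] by simp_all
  with assms show ?thesis unfolding torus_dist_def circle_dist_def by simp
qed

lemma measurable_destination:
  assumes "N \<in> measurable P (count_space UNIV)" "\<And>i. X i \<in> borel_measurable P"
  shows "destination N X \<in> borel_measurable (routing_space P Q)"
proof -
  have "(\<lambda>z. pick N X (fst (fst z)) (snd (fst (snd z)))) \<in> borel_measurable (routing_space P Q)"
    by (rule measurable_pick[OF assms]) (auto simp: routing_space_def graph_space_def cong: measurable_cong_sets)
  then show ?thesis by (simp add: destination_def case_prod_unfold)
qed


text \<open>
  The four terms bound the probabilities that there are too few nodes, that some cell is crowded, that
  source and destination are within \<open>D\<close> of each other, and that a long shortcut is found. By Fubini's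
  theorem the marks are integrated first, for fixed positions, source, destination and seed.
\<close>

lemma prob_reached_destination_le:
  fixes P :: "'a measure" and Q :: "'w measure"
  assumes pp: "poisson_process P 1 (square n) N X" and Q: "prob_space Q"
    and A: "decentralised_algorithm (space Q) A"
    and route: "(\<lambda>z. route c \<alpha> a n N X A z k) \<in> borel_measurable (routing_space P Q)"
    and R: "1 \<le> R" "local_radius c n \<le> R" and D: "R \<le> D" "real k * R \<le> D"
    and n: "1 \<le> n" and \<alpha>: "2 < \<alpha>" and a: "a \<le> a0" "0 \<le> a0"
  shows "measure (routing_space P Q)
      {z\<in>space (routing_space P Q). route c \<alpha> a n N X A z k = destination N X z}
    \<le> exp (- real n / 4) + real n * (real n + 1)\<^sup>2 * exp (- R\<^sup>2) + 5184 * D\<^sup>2 / n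
      + real (Suc k) * (a0 * (5184 / (1 - 2 powr (2 - \<alpha>)) * R powr (2 - \<alpha>)))"
proof -
  define U where "U = uniform_measure lborel {0..<1::real}"
  define Y where "Y = (U \<Otimes>\<^sub>M U) \<Otimes>\<^sub>M Q"
  define \<Lambda> where "\<Lambda> = real (Suc k) * (a0 * (5184 / (1 - 2 powr (2 - \<alpha>)) * R powr (2 - \<alpha>)))"
  let ?RS = "routing_space P Q"
  have RS: "?RS = (P \<Otimes>\<^sub>M edge_marks) \<Otimes>\<^sub>M Y"
    by (simp add: routing_space_def graph_space_def Y_def U_def)
  interpret P: prob_space P using pp by (rule prob_space_P)
  interpret E: prob_space edge_marks by (rule prob_space_edge_marks)
  interpret U: prob_space U unfolding U_def by (rule prob_space_uniform01)
  interpret Q: prob_space Q by (rule Q)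
  interpret UU: pair_prob_space U U ..
  interpret Y: prob_space Y unfolding Y_def by (intro prob_space_pair UU.prob_space_axioms Q)
  interpret G: prob_space "P \<Otimes>\<^sub>M edge_marks"
    by (intro prob_space_pair P.prob_space_axioms E.prob_space_axioms)
  interpret PY: pair_prob_space P Y ..
  interpret GY: pair_prob_space "P \<Otimes>\<^sub>M edge_marks" Y ..
  have \<Lambda>: "0 \<le> \<Lambda>"
  proof -
    have "2 powr (2 - \<alpha>) < 1" using \<alpha> by (auto simp: powr_less_one)
    then show ?thesis using a by (auto simp: \<Lambda>_def)
  qed
  note N = N_measurable[OF pp] and X = X_measurable[OF pp]
  define S where "S = {z\<in>space ?RS. route c \<alpha> a n N X A z k = destination N X z}"
  have "Measurable.pred ?RS (\<lambda>z. route c \<alpha> a n N X A z k = destination N X z)"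
    using route measurable_destination[where Q=Q, OF N X] by measurable
  then have S: "S \<in> sets ((P \<Otimes>\<^sub>M edge_marks) \<Otimes>\<^sub>M Y)" unfolding S_def RS by simp
  define Bad where "Bad = {\<omega>\<in>space P. \<not> sparse_cells n R (points N X \<omega>)}
    \<union> {\<omega>\<in>space P. real (card (points N X \<omega> \<inter> square n)) \<le> n / 4}"
  have few: "{\<omega>\<in>space P. real (card (points N X \<omega> \<inter> square n)) \<le> n / 4} \<in> sets P"
  proof -
    have "(\<lambda>\<omega>. real (card (points N X \<omega> \<inter> square n))) \<in> borel_measurable P"
      by (rule measurable_compose[OF count_measurable[OF pp square_borel order_refl]]) simp
    then show ?thesis by measurable
  qed
  note not_sparse = sets.sets_Collect_neg[OF sparse_cells_measurable[OF pp, of R]]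
  have Bad: "Bad \<in> sets P" unfolding Bad_def by (intro sets.Un not_sparse few)
  define Close where "Close = {x\<in>space (P \<Otimes>\<^sub>M Y). fst x \<notin> Bad \<and>
     torus_dist n (pick N X (fst x) (fst (fst (snd x)))) (pick N X (fst x) (snd (fst (snd x)))) \<le> D}"
  have Close: "Close \<in> sets (P \<Otimes>\<^sub>M Y)"
  proof -
    have "(\<lambda>x. torus_dist n (pick N X (fst x) (fst (fst (snd x)))) (pick N X (fst x) (snd (fst (snd x)))))
        \<in> borel_measurable (P \<Otimes>\<^sub>M Y)"
      by (intro measurable_torus_dist measurable_pick[OF N X])
         (auto simp: Y_def U_def cong: measurable_cong_sets)
    then show ?thesis unfolding Close_def using Bad by measurable
  qed
  \<comment> \<open>Bounds, for given positions and choices, the probability over the marks that the destination is reached.\<close>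
  define h where "h x = (indicator Bad (fst x) + indicator Close x + ennreal \<Lambda> :: ennreal)" for x
  have h: "h \<in> borel_measurable (P \<Otimes>\<^sub>M Y)" unfolding h_def using Bad Close by measurable
  have AE_Y: "AE y in Y. fst (fst y) \<in> {0..<1} \<and> snd (fst y) \<in> {0..<1}"
  proof -
    have "AE x in U \<Otimes>\<^sub>M U. fst x \<in> {0..<1} \<and> snd x \<in> {0..<1}"
    proof (rule UU.AE_pair_measure)
      have [measurable_cong]: "sets U = sets borel" by (simp add: U_def)
      show "{x \<in> space (U \<Otimes>\<^sub>M U). fst x \<in> {0..<1} \<and> snd x \<in> {0..<1}} \<in> sets (U \<Otimes>\<^sub>M U)" by measurable
      show "AE x in U. AE y in U. fst (x, y) \<in> {0..<1} \<and> snd (x, y) \<in> {0..<1}"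
        using AE_uniform01 unfolding U_def by eventually_elim (use AE_uniform01 in auto)
    qed
    then have "AE x in distr Y (U \<Otimes>\<^sub>M U) fst. fst x \<in> {0..<1} \<and> snd x \<in> {0..<1}"
      unfolding Y_def Q.distr_pair_fst .
    then show ?thesis by (rule AE_distrD[rotated]) (simp add: Y_def)
  qed
  have good: "N \<omega> = card (points N X \<omega> \<inter> square n) \<and> sparse_cells n R (points N X \<omega>) \<and> real n / 4 < real (N \<omega>)"
    if "\<omega> \<in> space P" "\<omega> \<notin> Bad" "inj_on (\<lambda>i. X i \<omega>) {..<N \<omega>}" "points N X \<omega> \<subseteq> square n" for \<omega>
  proof -
    have "card (points N X \<omega>) = N \<omega>" using that by (simp add: points_def card_image)
    moreover have "points N X \<omega> \<inter> square n = points N X \<omega>" using that by blast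
    ultimately show ?thesis using that by (auto simp: Bad_def)
  qed
  have "emeasure ?RS S = (\<integral>\<^sup>+z. indicator S z \<partial>((P \<Otimes>\<^sub>M edge_marks) \<Otimes>\<^sub>M Y))"
    using S by (simp add: RS)
  also have "\<dots> = (\<integral>\<^sup>+y. \<integral>\<^sup>+g. indicator S (g, y) \<partial>(P \<Otimes>\<^sub>M edge_marks) \<partial>Y)"
    using S by (intro GY.nn_integral_snd[symmetric]) simp
  also have "\<dots> = (\<integral>\<^sup>+y. \<integral>\<^sup>+\<omega>. \<integral>\<^sup>+u. indicator S ((\<omega>, u), y) \<partial>edge_marks \<partial>P \<partial>Y)"
  proof (rule nn_integral_cong)
    fix y assume "y \<in> space Y"
    then have "(\<lambda>g. indicator S (g, y) :: ennreal) \<in> borel_measurable (P \<Otimes>\<^sub>M edge_marks)"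
      using S by (intro measurable_Pair1[of "indicator S"]) simp_all
    then show "(\<integral>\<^sup>+g. indicator S (g, y) \<partial>(P \<Otimes>\<^sub>M edge_marks)) = (\<integral>\<^sup>+\<omega>. \<integral>\<^sup>+u. indicator S ((\<omega>, u), y) \<partial>edge_marks \<partial>P)"
      by (rule E.nn_integral_fst[symmetric])
  qed
  also have "\<dots> \<le> (\<integral>\<^sup>+y. \<integral>\<^sup>+\<omega>. h (\<omega>, y) \<partial>P \<partial>Y)"
  proof (rule nn_integral_mono_AE)
    show "AE y in Y. (\<integral>\<^sup>+\<omega>. \<integral>\<^sup>+u. indicator S ((\<omega>, u), y) \<partial>edge_marks \<partial>P) \<le> (\<integral>\<^sup>+\<omega>. h (\<omega>, y) \<partial>P)"
      using AE_Y AE_space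
    proof eventually_elim
      case (elim y)
      obtain v v' w where y: "y = ((v, v'), w)" by (metis prod.collapse)
      have w: "w \<in> space Q" and v: "v \<in> {0..<1}" "v' \<in> {0..<1}"
        using elim by (auto simp: y Y_def space_pair_measure)
      show ?case
      proof (rule nn_integral_mono_AE)
        show "AE \<omega> in P. (\<integral>\<^sup>+u. indicator S ((\<omega>, u), y) \<partial>edge_marks) \<le> h (\<omega>, y)"
          using AE_points[OF pp] AE_space
        proof eventually_elim
          case (elim \<omega>)
          have one: "(\<integral>\<^sup>+u. indicator S ((\<omega>, u), y) \<partial>edge_marks) \<le> 1"
          proof -
            have "(\<integral>\<^sup>+u. indicator S ((\<omega>, u), y) \<partial>edge_marks) \<le> (\<integral>\<^sup>+u. 1 \<partial>edge_marks)"
              by (intro nn_integral_mono) (auto simp: indicator_def)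
            then show ?thesis by (simp add: E.emeasure_space_1)
          qed
          consider "\<omega> \<in> Bad" | "\<omega> \<notin> Bad" "torus_dist n (pick N X \<omega> v) (pick N X \<omega> v') \<le> D"
            | "\<omega> \<notin> Bad" "D < torus_dist n (pick N X \<omega> v) (pick N X \<omega> v')" by linarith
          then show ?case
          proof cases
            case 1
            then have "1 \<le> h (\<omega>, y)" by (simp add: h_def add_increasing2)
            with one show ?thesis by (rule order_trans)
          next
            case 2
            then have "(\<omega>, y) \<in> Close"
              using elim \<open>y \<in> space Y\<close> by (simp add: Close_def y space_pair_measure)
            then have "1 \<le> h (\<omega>, y)" by (simp add: h_def add_increasing2 add_increasing)
            with one show ?thesis by (rule order_trans)
          next
            case 3
            note g = good[OF _ 3(1)]
            have "(\<integral>\<^sup>+u. indicator S ((\<omega>, u), y) \<partial>edge_marks)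
               \<le> (\<integral>\<^sup>+u. indicator {z. route c \<alpha> a n N X A z k = destination N X z} ((\<omega>, u), (v, v'), w) \<partial>edge_marks)"
              by (intro nn_integral_mono) (auto simp: indicator_def S_def y)
            also have "\<dots> \<le> ennreal \<Lambda>"
              unfolding \<Lambda>_def using elim g D 3 R n \<alpha> a A w v
              by (intro nn_integral_reached_le) auto
            also have "\<dots> \<le> h (\<omega>, y)" by (simp add: h_def)
            finally show ?thesis .
          qed
        qed
      qed
    qed
  qed
  also have "\<dots> = (\<integral>\<^sup>+\<omega>. \<integral>\<^sup>+y. h (\<omega>, y) \<partial>Y \<partial>P)"
    by (rule PY.Fubini[OF h])
  also have "\<dots> \<le> (\<integral>\<^sup>+\<omega>. indicator Bad \<omega> + (ennreal (5184 * D\<^sup>2 / n) + ennreal \<Lambda>) \<partial>P)"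
  proof (rule nn_integral_mono_AE)
    show "AE \<omega> in P. (\<integral>\<^sup>+y. h (\<omega>, y) \<partial>Y) \<le> indicator Bad \<omega> + (ennreal (5184 * D\<^sup>2 / n) + ennreal \<Lambda>)"
      using AE_points[OF pp] AE_space
    proof eventually_elim
      case (elim \<omega>)
      have Close_sec: "(\<lambda>y. indicator Close (\<omega>, y) :: ennreal) \<in> borel_measurable Y"
        using Close elim by (intro measurable_Pair2[of "indicator Close"]) simp_all
      have "(\<integral>\<^sup>+y. h (\<omega>, y) \<partial>Y) = indicator Bad \<omega> + (\<integral>\<^sup>+y. indicator Close (\<omega>, y) \<partial>Y) + ennreal \<Lambda>"
        using Close_sec unfolding h_def by (simp add: nn_integral_add Y.emeasure_space_1)
      moreover have "(\<integral>\<^sup>+y. indicator Close (\<omega>, y) \<partial>Y) \<le> ennreal (5184 * D\<^sup>2 / n)"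
      proof (cases "\<omega> \<in> Bad")
        case True
        then show ?thesis by (simp add: Close_def)
      next
        case False
        let ?C = "{q. torus_dist n (pick N X \<omega> (fst q)) (pick N X \<omega> (snd q)) \<le> D}"
        have C: "?C \<in> sets (U \<Otimes>\<^sub>M U)"
        proof -
          have "(\<lambda>q. torus_dist n (pick N X \<omega> (fst q)) (pick N X \<omega> (snd q))) \<in> borel_measurable (U \<Otimes>\<^sub>M U)"
            using elim by (intro measurable_torus_dist measurable_pick[OF N X])
               (auto simp: U_def cong: measurable_cong_sets)
          then have "{q\<in>space (U \<Otimes>\<^sub>M U). torus_dist n (pick N X \<omega> (fst q)) (pick N X \<omega> (snd q)) \<le> D} \<in> sets (U \<Otimes>\<^sub>M U)"
            by measurable
          then show ?thesis by (simp add: U_def space_pair_measure)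
        qed
        have "(\<integral>\<^sup>+y. indicator Close (\<omega>, y) \<partial>Y) \<le> (\<integral>\<^sup>+y. indicator ?C (fst y) \<partial>Y)"
          by (intro nn_integral_mono) (auto simp: indicator_def Close_def)
        also have "\<dots> = (\<integral>\<^sup>+q. indicator ?C q \<partial>distr Y (U \<Otimes>\<^sub>M U) fst)"
          using C by (intro nn_integral_distr[symmetric]) (auto simp: Y_def)
        also have "\<dots> = (\<integral>\<^sup>+q. indicator ?C q \<partial>(U \<Otimes>\<^sub>M U))" unfolding Y_def Q.distr_pair_fst ..
        also have "\<dots> = (\<integral>\<^sup>+v. \<integral>\<^sup>+v'. indicator ?C (v, v') \<partial>U \<partial>U)"
          using C by (intro U.nn_integral_fst[symmetric]) simp
        also have "\<dots> \<le> ennreal (5184 * D\<^sup>2 / n)"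
          unfolding U_def using elim good[OF _ False] R D n by (intro nn_integral_close_le) auto
        finally show ?thesis .
      qed
      ultimately show ?case by (simp add: add.assoc add_mono)
    qed
  qed
  also have "\<dots> = ennreal (P.prob Bad) + (ennreal (5184 * D\<^sup>2 / n) + ennreal \<Lambda>)"
    using Bad by (simp add: nn_integral_add P.emeasure_space_1 flip: P.emeasure_eq_measure)
  also have "\<dots> = ennreal (P.prob Bad + (5184 * D\<^sup>2 / n + \<Lambda>))"
    using \<Lambda> by (simp add: ennreal_plus)
  finally have "emeasure ?RS S \<le> ennreal (P.prob Bad + (5184 * D\<^sup>2 / n + \<Lambda>))" .
  then have "measure ?RS S \<le> P.prob Bad + (5184 * D\<^sup>2 / n + \<Lambda>)"
    using \<Lambda> unfolding measure_def by (intro enn2real_leI) auto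
  moreover have "P.prob Bad \<le> real n * (real n + 1)\<^sup>2 * exp (- R\<^sup>2) + exp (- real n / 4)"
  proof -
    have "P.prob Bad \<le> P.prob {\<omega>\<in>space P. \<not> sparse_cells n R (points N X \<omega>)}
        + P.prob {\<omega>\<in>space P. real (card (points N X \<omega> \<inter> square n)) \<le> n / 4}"
      unfolding Bad_def by (intro measure_Un_le not_sparse few)
    then show ?thesis using prob_not_sparse_cells[OF pp, of R] prob_few_points[OF pp] R by linarith
  qed
  ultimately show ?thesis by (simp add: S_def \<Lambda>_def)
qed

section \<open>The limit\<close>

text \<open>
  Once the destination is reached the route stays there, so the number of hops can be read off from
  the node at a single time.
\<close>

lemma less_hops_iff:
  assumes x: "0 \<le> x" and absorbing: "\<And>k m. f k = t \<Longrightarrow> k \<le> m \<Longrightarrow> f m = t"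
  shows "ereal x < ereal_of_enat (hops f t) \<longleftrightarrow> f (nat \<lfloor>x\<rfloor>) \<noteq> t"
proof
  assume less: "ereal x < ereal_of_enat (hops f t)"
  show "f (nat \<lfloor>x\<rfloor>) \<noteq> t"
  proof
    assume reached: "f (nat \<lfloor>x\<rfloor>) = t"
    then have "(LEAST k. f k = t) \<le> nat \<lfloor>x\<rfloor>" by (rule Least_le)
    then have "real (LEAST k. f k = t) \<le> x" using x by linarith
    moreover have "hops f t = enat (LEAST k. f k = t)" using reached by (auto simp: hops_def)
    ultimately show False using less by simp
  qed
next
  assume not_reached: "f (nat \<lfloor>x\<rfloor>) \<noteq> t"
  show "ereal x < ereal_of_enat (hops f t)"
  proof (cases "\<exists>k. f k = t")
    case True
    then have "f (LEAST k. f k = t) = t" by (rule LeastI_ex)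
    then have "nat \<lfloor>x\<rfloor> < (LEAST k. f k = t)" using absorbing not_reached by (meson not_le)
    then have "x < real (LEAST k. f k = t)" using x by linarith
    then show ?thesis using True by (simp add: hops_def)
  qed (simp add: hops_def)
qed

lemma route_absorbing:
  assumes "route c \<alpha> a n N X A z k = destination N X z" "k \<le> m"
  shows "route c \<alpha> a n N X A z m = destination N X z"
proof -
  obtain \<omega> u v v' w where z: "z = ((\<omega>, u), (v, v'), w)" by (metis prod.collapse)
  show ?thesis
    using last_visited_eq_destination[OF _ assms(2)] assms(1)
    by (simp add: z route_eq_visited destination_def)
qed

theorem theorem4p2:
  fixes P :: "nat \<Rightarrow> 'a measure" and N :: "nat \<Rightarrow> 'a \<Rightarrow> nat" and X :: "nat \<Rightarrow> nat \<Rightarrow> 'a \<Rightarrow> point"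
    and Q :: "nat \<Rightarrow> 'w measure" and A :: "nat \<Rightarrow> 'w algorithm"
    and a :: "nat \<Rightarrow> real" and \<alpha> c dbar \<gamma> :: real
  assumes "\<alpha> > 2" and "c > 0" and "dbar > 0"
    and "\<And>n. poisson_process (P n) 1 (square n) (N n) (X n)"
    and "\<forall>\<^sub>F n in sequentially. mean_shortcuts c \<alpha> (a n) n (P n) (N n) (X n) = dbar"
    and "\<And>n. prob_space (Q n)"
    and "\<And>n. decentralised_algorithm (space (Q n)) (A n)"
    and "\<And>n k. (\<lambda>z. route c \<alpha> (a n) n (N n) (X n) (A n) z k)
                  \<in> borel_measurable (routing_space (P n) (Q n))"
    and "\<gamma> < (\<alpha> - 2) / (2 * (\<alpha> - 1))"
  shows "(\<lambda>n. measure (routing_space (P n) (Q n))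
            {z \<in> space (routing_space (P n) (Q n)).
               ereal (real n powr \<gamma>) <
               ereal_of_enat (hops (route c \<alpha> (a n) n (N n) (X n) (A n) z) (destination (N n) (X n) z))})
         \<longlonglongrightarrow> 1"
proof -
  note \<alpha> = assms(1) and c = assms(2) and dbar = assms(3) and pp = assms(4) and mean = assms(5)
    and Q = assms(6) and A = assms(7) and route = assms(8)
  have \<alpha>0: "0 \<le> \<alpha>" using \<alpha> by simp
  \<comment> \<open>As \<open>g \<ge> 0\<close>, also \<open>K + 1\<close> is at most \<open>2 n\<^sup>g\<close>.\<close>
  define g where "g = max \<gamma> 0"
  have g: "\<gamma> \<le> g" "0 \<le> g" "g < (\<alpha> - 2) / (2 * (\<alpha> - 1))" using \<alpha> assms(9) by (auto simp: g_def)
  \<comment> \<open>This is where the bound for \<open>\<gamma>\<close> comes from: it leaves room for the exponent \<open>\<beta>\<close> of \<open>R\<close>.\<close>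
  have "g / (\<alpha> - 2) < 1 / 2 - g" using g(3) \<alpha> by (simp add: field_simps)
  then obtain \<beta> where \<beta>: "g / (\<alpha> - 2) < \<beta>" "\<beta> < 1 / 2 - g" using dense by blast
  have \<beta>0: "0 < \<beta>" using \<beta>(1) g(2) \<alpha> by (auto intro: le_less_trans[rotated])
  define \<epsilon> where "\<epsilon> = (\<beta> * (\<alpha> - 2) - g) / 2"
  have \<epsilon>: "0 < \<epsilon>" using \<beta>(1) \<alpha> by (simp add: \<epsilon>_def field_simps)
  \<comment> \<open>Half of the slack \<open>\<beta> (\<alpha> - 2) - g\<close> pays for the growth of \<open>a\<^sub>n\<close>.\<close>
  define \<delta> where "\<delta> = min (1 / 4) (\<epsilon> / \<alpha>)"
  have \<delta>: "0 < \<delta>" "\<delta> < 1 / 2" "\<delta> * \<alpha> \<le> \<epsilon>"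
    using \<epsilon> \<alpha> by (auto simp: \<delta>_def min_def field_simps)
  define R where "R n = real n powr \<beta>" for n :: nat
  define D where "D n = real n powr (g + \<beta>)" for n :: nat
  define K where "K n = nat \<lfloor>real n powr \<gamma>\<rfloor>" for n :: nat
  define S where "S n = {z \<in> space (routing_space (P n) (Q n)).
    route c \<alpha> (a n) n (N n) (X n) (A n) z (K n) = destination (N n) (X n) z}" for n
  define C where "C = 8 powr \<alpha> * (5184 / (1 - 2 powr (2 - \<alpha>)))"
  have C: "0 \<le> C" using \<alpha> by (auto simp: C_def powr_less_one intro!: mult_nonneg_nonneg divide_nonneg_pos)
  define bound where "bound n = exp (- real n / 4) + real n * (real n + 1)\<^sup>2 * exp (- (real n powr \<beta>)\<^sup>2)
     + 5184 * real n powr (2 * (g + \<beta>) - 1) + 2 * C * real n powr (- \<epsilon>)" for n :: nat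
  have "(\<lambda>n. exp (- real n / 4)) \<longlonglongrightarrow> 0" by real_asymp
  moreover have "(\<lambda>n. real n * (real n + 1)\<^sup>2 * exp (- (real n powr \<beta>)\<^sup>2)) \<longlonglongrightarrow> 0"
    using \<beta>0 by real_asymp
  moreover have "(\<lambda>n. 5184 * real n powr (2 * (g + \<beta>) - 1)) \<longlonglongrightarrow> 0"
  proof -
    define e where "e = 1 - 2 * (g + \<beta>)"
    have "0 < e" using \<beta>(2) by (simp add: e_def)
    then have "(\<lambda>n. 5184 * real n powr (- e)) \<longlonglongrightarrow> 0" by real_asymp
    then show ?thesis by (simp add: e_def)
  qed
  moreover have "(\<lambda>n. 2 * C * real n powr (- \<epsilon>)) \<longlonglongrightarrow> 2 * C * 0"
    using \<epsilon> by (intro tendsto_mult tendsto_const) real_asymp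
  ultimately have "bound \<longlonglongrightarrow> 0 + 0 + 0 + 2 * C * 0"
    unfolding bound_def by (intro tendsto_add)
  then have bound_0: "bound \<longlonglongrightarrow> 0" by simp
  have local: "\<forall>\<^sub>F n in sequentially. local_radius c n \<le> R n"
    unfolding local_radius_def R_def using c \<beta>0 by real_asymp
  have S_le: "\<forall>\<^sub>F n in sequentially. measure (routing_space (P n) (Q n)) (S n) \<le> bound n"
    using local eventually_edge_constant_le[OF pp mean dbar \<alpha>0 c \<delta>(1,2)] eventually_ge_at_top[of 1]
  proof (eventually_elim)
    case (elim n)
    have n: "1 \<le> real n" using elim by simp
    have R: "1 \<le> R n" "R n \<le> D n" using n \<beta>0 g by (auto simp: R_def D_def ge_one_powr_ge_zero powr_mono)
    have K: "real (K n) \<le> real n powr g"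
    proof -
      have "real (K n) \<le> real n powr \<gamma>" by (simp add: K_def)
      also have "\<dots> \<le> real n powr g" using n g by (intro powr_mono) auto
      finally show ?thesis .
    qed
    have KR: "real (K n) * R n \<le> D n"
      using K unfolding R_def D_def powr_add by (intro mult_right_mono) auto
    have "measure (routing_space (P n) (Q n)) (S n) \<le> exp (- real n / 4) + real n * (real n + 1)\<^sup>2 * exp (- (R n)\<^sup>2)
        + 5184 * (D n)\<^sup>2 / n
        + real (Suc (K n)) * ((8 powr \<alpha> * real n powr (\<delta> * \<alpha>)) * (5184 / (1 - 2 powr (2 - \<alpha>)) * R n powr (2 - \<alpha>)))"
      unfolding S_def using elim R KR \<alpha>
      by (intro prob_reached_destination_le[OF pp Q A route]) auto
    moreover have "5184 * (D n)\<^sup>2 / n = 5184 * real n powr (2 * (g + \<beta>) - 1)"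
      using n by (simp add: D_def powr_diff powr_power)
    moreover have "real (Suc (K n)) * ((8 powr \<alpha> * real n powr (\<delta> * \<alpha>)) * (5184 / (1 - 2 powr (2 - \<alpha>)) * R n powr (2 - \<alpha>)))
        \<le> 2 * C * real n powr (- \<epsilon>)"
    proof -
      have "real (Suc (K n)) * ((8 powr \<alpha> * real n powr (\<delta> * \<alpha>)) * (5184 / (1 - 2 powr (2 - \<alpha>)) * R n powr (2 - \<alpha>)))
         = C * (real (Suc (K n)) * (real n powr (\<delta> * \<alpha>) * real n powr (\<beta> * (2 - \<alpha>))))"
        by (simp add: C_def R_def powr_powr)
      also have "\<dots> \<le> C * ((2 * real n powr g) * (real n powr (\<delta> * \<alpha>) * real n powr (\<beta> * (2 - \<alpha>))))"
        using K ge_one_powr_ge_zero[OF n g(2)] C by (intro mult_left_mono mult_right_mono) auto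
      also have "\<dots> = 2 * C * real n powr (g + \<delta> * \<alpha> + \<beta> * (2 - \<alpha>))"
        by (simp add: powr_add)
      also have "\<dots> \<le> 2 * C * real n powr (- \<epsilon>)"
      proof (intro mult_left_mono powr_mono)
        have "2 * \<epsilon> = \<beta> * (\<alpha> - 2) - g" by (simp add: \<epsilon>_def)
        then show "g + \<delta> * \<alpha> + \<beta> * (2 - \<alpha>) \<le> - \<epsilon>" using \<delta>(3) by (simp add: algebra_simps)
      qed (use C n in auto)
      finally show ?thesis .
    qed
    ultimately show ?case unfolding bound_def by (simp add: R_def)
  qed
  have "(\<lambda>n. measure (routing_space (P n) (Q n)) (S n)) \<longlonglongrightarrow> 0"
    using S_le bound_0 by (intro tendsto_sandwich[OF _ S_le tendsto_const bound_0]) auto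
  then have "(\<lambda>n. 1 - measure (routing_space (P n) (Q n)) (S n)) \<longlonglongrightarrow> 1 - 0"
    by (intro tendsto_diff tendsto_const)
  moreover have "measure (routing_space (P n) (Q n))
      {z \<in> space (routing_space (P n) (Q n)).
         ereal (real n powr \<gamma>) < ereal_of_enat (hops (route c \<alpha> (a n) n (N n) (X n) (A n) z) (destination (N n) (X n) z))}
    = 1 - measure (routing_space (P n) (Q n)) (S n)" for n
  proof -
    interpret prob_space "routing_space (P n) (Q n)"
      unfolding routing_space_def graph_space_def
      by (intro prob_space_pair prob_space_P[OF pp] prob_space_edge_marks prob_space_uniform01 Q)
    have "Measurable.pred (routing_space (P n) (Q n))
        (\<lambda>z. route c \<alpha> (a n) n (N n) (X n) (A n) z (K n) = destination (N n) (X n) z)"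
      using route[of n "K n"]
        measurable_destination[where Q="Q n", OF N_measurable[OF pp[of n]] X_measurable[OF pp[of n]]]
      by measurable
    then have "S n \<in> events" unfolding S_def by simp
    moreover have "ereal (real n powr \<gamma>) < ereal_of_enat (hops (route c \<alpha> (a n) n (N n) (X n) (A n) z) (destination (N n) (X n) z))
        \<longleftrightarrow> route c \<alpha> (a n) n (N n) (X n) (A n) z (K n) \<noteq> destination (N n) (X n) z" for z
      unfolding K_def by (rule less_hops_iff[OF powr_ge_zero route_absorbing])
    then have "{z \<in> space (routing_space (P n) (Q n)).
         ereal (real n powr \<gamma>) < ereal_of_enat (hops (route c \<alpha> (a n) n (N n) (X n) (A n) z) (destination (N n) (X n) z))}
       = space (routing_space (P n) (Q n)) - S n"
      by (auto simp: S_def)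
    ultimately show ?thesis by (simp add: prob_compl)
  qed
  ultimately show ?thesis by simp
qed

end
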